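(* Let $(\gamma,\eta):I\to X\times S$ be a Legendre immersion with curvature $(\alpha,\kappa)$ such that $\kappa$ does not vanish, let $e_\gamma(t)=\gamma(t)-\frac{\alpha(t)}{\kappa(t)}\eta(t)$ be its evolute, and let $\nu(t)=-b^{-1}(\eta(t))$, where $b^{-1}$ denotes the inverse of the bijective restriction $b|_S:S\to S$. Then the pair $(e_\gamma,\nu)$ is a Legendre immersion with associated curvature given by the equalities $$e_\gamma'(t)=-\frac{d}{dt}\left(\frac{\alpha(t)}{\kappa(t)}\right)\eta(t)\quad\text{and}\quad \nu'(t)=\beta(t)\eta(t).$$ Since $\eta(t)=-b(\nu(t))$, it follows that the curvature pair of $(e_\gamma,\nu)$ is given by $\left(\frac{d}{dt}\left(\frac{\alpha}{\kappa}\right),-\beta\right)$. Moreover, the function $-\beta$ is given by $$-\beta(t)=\frac{\kappa(t)}{\rho(\nu(t))}.$$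
   Context: Let $(X,\|\cdot\|)$ be a two-dimensional real normed space with unit circle $S=\{x\in X:\|x\|=1\}$. The plane is assumed smooth ($S$ is a smooth curve) and strictly convex ($S$ contains no line segment). Fix a nondegenerate symplectic (alternating) bilinear form $[\cdot,\cdot]$ on $X$. For $x,y\in X$, $x\dashv_B y$ (Birkhoff orthogonality) means $\|x+ty\|\ge\|x\|$ for all $t\in\mathbb{R}$. For $v\in X\setminus\{o\}$ let $b(v)\in S$ be the unique vector with $v\dashv_B b(v)$ and $[v,b(v)]>0$. Define $\rho:S\to\mathbb{R}$ by $\rho(v)=\|\mathrm{D}b_v(b(v))\|$, where $\mathrm{D}b_v$ is the differential of $b$ at $v$. Let $I$ be an interval. A Legendre curve is a smooth map $(\gamma,\eta):I\rightarrow X\times S$ with $\eta(t)\dashv_B\gamma'(t)$ for all $t\in I$; it is a Legendre immersion if $\gamma'$ and $\eta'$ never vanish simultaneously. Put $\xi(t)=b(\eta(t))$. There are smooth functions $\alpha,\kappa:I\to\mathbb{R}$ with $\gamma'(t)=\alpha(t)\xi(t)$ and $\eta'(t)=\kappa(t)\xi(t)$; the pair $(\alpha,\kappa)$ is called the curvature (pair) of $(\gamma,\eta)$.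
   Formalization: The formal theorem adds the hypothesis that ρ(ν(t)) ≠ 0 for all t in I; without it ν need not be differentiable (e.g. the plane with unit circle x⁴+y⁴=1, γ=η near (0,1)), and the formula κ/ρ(ν) is undefined. *)

theory Defs
  imports "HOL-Analysis.Analysis"
begin

text \<open>Smoothness means class C-infinity. At an end point of a non-open interval the derivatives
  are one-sided; \<open>F n\<close> is the \<open>n\<close>-th derivative of \<open>f\<close> on \<open>I\<close>.\<close>

definition smooth_on :: "real set \<Rightarrow> (real \<Rightarrow> 'a::real_normed_vector) \<Rightarrow> bool" where
  "smooth_on I f \<longleftrightarrow>
     (\<exists>F :: nat \<Rightarrow> real \<Rightarrow> 'a.
        (\<forall>t\<in>I. F 0 t = f t) \<and>
        (\<forall>n. \<forall>t\<in>I. (F n has_vector_derivative F (Suc n) t) (at t within I)))"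

definition smooth_closed_curve :: "'a::real_normed_vector set \<Rightarrow> bool" where
  "smooth_closed_curve C \<longleftrightarrow>
     (\<exists>(c :: real \<Rightarrow> 'a) L.
        smooth_on UNIV c \<and> (\<forall>s. vector_derivative c (at s) \<noteq> 0) \<and>
        0 < L \<and> (\<forall>s. c (s + L) = c s) \<and> inj_on c {0..<L} \<and> range c = C)"

definition symplectic_form :: "('a::real_vector \<Rightarrow> 'a \<Rightarrow> real) \<Rightarrow> bool" where
  "symplectic_form \<omega> \<longleftrightarrow>
     bilinear \<omega> \<and> (\<forall>x. \<omega> x x = 0) \<and> (\<forall>x. (\<forall>y. \<omega> x y = 0) \<longrightarrow> x = 0)"

definition birkhoff_orth :: "'a::real_normed_vector \<Rightarrow> 'a \<Rightarrow> bool" where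
  "birkhoff_orth x y \<longleftrightarrow> (\<forall>t::real. norm (x + t *\<^sub>R y) \<ge> norm x)"

text \<open>The description determines a unique vector for every \<open>v \<noteq> 0\<close> in a smooth plane; the value
  at \<open>0\<close> is irrelevant.\<close>

definition birkhoff_map :: "('a::real_normed_vector \<Rightarrow> 'a \<Rightarrow> real) \<Rightarrow> 'a \<Rightarrow> 'a" where
  "birkhoff_map \<omega> v = (THE w. w \<in> sphere 0 1 \<and> birkhoff_orth v w \<and> \<omega> v w > 0)"

text \<open>The differential is that of the map on the punctured plane, not only of its restriction
  to the unit circle.\<close>

definition rho :: "('a::real_normed_vector \<Rightarrow> 'a \<Rightarrow> real) \<Rightarrow> 'a \<Rightarrow> real" where
  "rho \<omega> v = norm (frechet_derivative (birkhoff_map \<omega>) (at v) (birkhoff_map \<omega> v))"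

definition legendre_curve ::
  "real set \<Rightarrow> (real \<Rightarrow> 'a::real_normed_vector) \<Rightarrow> (real \<Rightarrow> 'a) \<Rightarrow> bool" where
  "legendre_curve I \<gamma> \<eta> \<longleftrightarrow>
     smooth_on I \<gamma> \<and> smooth_on I \<eta> \<and> (\<forall>t\<in>I. \<eta> t \<in> sphere 0 1) \<and>
     (\<forall>t\<in>I. birkhoff_orth (\<eta> t) (vector_derivative \<gamma> (at t within I)))"

definition legendre_immersion ::
  "real set \<Rightarrow> (real \<Rightarrow> 'a::real_normed_vector) \<Rightarrow> (real \<Rightarrow> 'a) \<Rightarrow> bool" where
  "legendre_immersion I \<gamma> \<eta> \<longleftrightarrow>
     legendre_curve I \<gamma> \<eta> \<and>
     (\<forall>t\<in>I. \<not> (vector_derivative \<gamma> (at t within I) = 0 \<and>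
                vector_derivative \<eta> (at t within I) = 0))"

definition curvature_pair ::
  "('a::real_normed_vector \<Rightarrow> 'a \<Rightarrow> real) \<Rightarrow> real set \<Rightarrow> (real \<Rightarrow> 'a) \<Rightarrow> (real \<Rightarrow> 'a) \<Rightarrow>
    (real \<Rightarrow> real) \<Rightarrow> (real \<Rightarrow> real) \<Rightarrow> bool" where
  "curvature_pair \<omega> I \<gamma> \<eta> \<alpha> \<kappa> \<longleftrightarrow>
     smooth_on I \<alpha> \<and> smooth_on I \<kappa> \<and>
     (\<forall>t\<in>I. vector_derivative \<gamma> (at t within I) = \<alpha> t *\<^sub>R birkhoff_map \<omega> (\<eta> t)) \<and>
     (\<forall>t\<in>I. vector_derivative \<eta> (at t within I) = \<kappa> t *\<^sub>R birkhoff_map \<omega> (\<eta> t))"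

definition evolute ::
  "(real \<Rightarrow> 'a::real_normed_vector) \<Rightarrow> (real \<Rightarrow> 'a) \<Rightarrow> (real \<Rightarrow> real) \<Rightarrow> (real \<Rightarrow> real) \<Rightarrow>
    real \<Rightarrow> 'a" where
  "evolute \<gamma> \<eta> \<alpha> \<kappa> t = \<gamma> t - (\<alpha> t / \<kappa> t) *\<^sub>R \<eta> t"

definition evolute_normal ::
  "('a::real_normed_vector \<Rightarrow> 'a \<Rightarrow> real) \<Rightarrow> (real \<Rightarrow> 'a) \<Rightarrow> real \<Rightarrow> 'a" where
  "evolute_normal \<omega> \<eta> t = - inv_into (sphere 0 1) (birkhoff_map \<omega>) (\<eta> t)"

end

theory Submission
  imports Defs
begin

text \<open>
Let \<open>c\<close> parametrize the unit circle smoothly and regularly, with \<open>\<omega> (c s) (c' s) > 0\<close>. That \<open>v\<close> is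
Birkhoff orthogonal to \<open>w\<close> means that the line through \<open>v\<close> in the direction \<open>w\<close> supports the unit
ball, so the Birkhoff map \<open>b\<close> sends \<open>c s\<close> to the unit tangent \<open>c' s / norm (c' s)\<close>. It is onto
the circle because a linear functional attains its maximum there, and injective because a
supporting line of a strictly convex ball touches it only once. Hence \<open>\<nu>\<close> is the unique unit
field with \<open>b \<nu> = - \<eta>\<close>, and the curvature of the evolute comes from differentiating this equation.

The analytic part is to see that \<open>b\<close>, as a map on the punctured plane, is differentiable at the
points of the circle and that \<open>\<nu>\<close> is smooth. Both rest on \<open>smooth_ray_parameter\<close>: if \<open>g\<close> and
its derivative are linearly independent at \<open>s0\<close>, then the rays near the one through \<open>g s0\<close> are
smoothly parametrized by \<open>g\<close>, since the quotient of two linear functionals is a coordinate on rays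
and the inverse function theorem in one variable inverts it along \<open>g\<close>. For \<open>g = c\<close> this gives
differentiability of the norm and of \<open>b\<close>. For \<open>g = c'\<close> it recovers a point of the circle smoothly
from its tangent direction, and \<open>- \<eta>\<close> is the tangent direction at \<open>\<nu>\<close>. That \<open>c'\<close> is
independent of \<open>c''\<close> there is what \<open>rho \<noteq> 0\<close> provides (\<open>tangent_turns\<close>).

Since \<open>\<nu>\<close> runs on the circle, \<open>\<nu>'\<close> is parallel to \<open>b \<nu> = - \<eta>\<close>, say \<open>\<nu>' = \<beta> \<eta>\<close>. The chain rule
for \<open>b \<nu> = - \<eta>\<close> reads \<open>\<beta> Db (b \<nu>) = \<kappa> b \<eta>\<close>, so \<open>\<bar>\<beta>\<bar> rho = \<bar>\<kappa>\<bar>\<close> on taking norms. The sign is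
fixed by convexity: comparing the supporting lines at two points of the circle shows that \<open>b\<close> is
monotone with respect to \<open>\<omega>\<close> (\<open>birkhoff_map_monotone\<close>), and in the limit \<open>\<beta> \<kappa> \<le> 0\<close>. For the
evolute itself, the terms \<open>\<alpha> b \<eta>\<close> and \<open>(\<alpha> / \<kappa>) \<kappa> b \<eta>\<close> cancel in the product rule.
\<close>

section \<open>Smooth functions on sets without isolated points\<close>

text \<open>Recursion on the order lets the closure properties below be proved by induction on the number
  of derivatives taken. Order \<open>0\<close> can be vacuous because smoothness is the conjunction over all
  orders.\<close>

primrec times_differentiable_on :: "nat \<Rightarrow> real set \<Rightarrow> (real \<Rightarrow> 'a::real_normed_vector) \<Rightarrow> bool" where
  "times_differentiable_on 0 I f = True"
| "times_differentiable_on (Suc n) I f =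
     (\<exists>f'. (\<forall>t\<in>I. (f has_vector_derivative f' t) (at t within I)) \<and> times_differentiable_on n I f')"

lemma times_differentiable_on_SucI:
  assumes "\<And>t. t \<in> I \<Longrightarrow> (f has_vector_derivative f' t) (at t within I)"
    and "times_differentiable_on n I f'"
  shows "times_differentiable_on (Suc n) I f"
  using assms by auto

lemma times_differentiable_on_cong:
  assumes "times_differentiable_on n I f" "\<And>t. t \<in> I \<Longrightarrow> f t = g t"
  shows "times_differentiable_on n I g"
proof (cases n)
  case (Suc m)
  with assms(1) obtain f' where f': "\<forall>t\<in>I. (f has_vector_derivative f' t) (at t within I)"
    "times_differentiable_on m I f'" by auto
  have "(g has_vector_derivative f' t) (at t within I)" if "t \<in> I" for t
    by (rule has_vector_derivative_transform[OF that _ f'(1)[rule_format, OF that]])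
       (simp add: assms(2))
  then show ?thesis using f' Suc by auto
qed simp

lemma times_differentiable_on_Suc_D:
  "times_differentiable_on (Suc n) I f \<Longrightarrow> times_differentiable_on n I f"
proof (induction n arbitrary: f)
  case (Suc n)
  from Suc.prems obtain f' where "\<forall>t\<in>I. (f has_vector_derivative f' t) (at t within I)"
    "times_differentiable_on (Suc n) I f'" by (subst (asm) times_differentiable_on.simps(2)) blast
  then show ?case using Suc.IH by auto
qed simp

lemma times_differentiable_on_subset:
  "times_differentiable_on n I f \<Longrightarrow> J \<subseteq> I \<Longrightarrow> times_differentiable_on n J f"
proof (induction n arbitrary: f)
  case (Suc n)
  then show ?case
    by (simp, meson has_vector_derivative_within_subset subset_iff)
qed simp

lemma smooth_on_imp_times_differentiable_on:
  assumes "smooth_on I f"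
  shows "times_differentiable_on n I f"
proof -
  from assms obtain F where F: "\<forall>t\<in>I. F 0 t = f t"
    "\<forall>n. \<forall>t\<in>I. (F n has_vector_derivative F (Suc n) t) (at t within I)"
    unfolding smooth_on_def by blast
  have "times_differentiable_on n I (F m)" for m
    using F(2) by (induction n arbitrary: m) auto
  from times_differentiable_on_cong[OF this[of 0]] F(1) show ?thesis by blast
qed

lemma vector_derivative_times_differentiable_on:
  assumes "times_differentiable_on (Suc n) I f" and perf: "\<And>t. t \<in> I \<Longrightarrow> t islimpt I"
  shows "t \<in> I \<Longrightarrow> (f has_vector_derivative vector_derivative f (at t within I)) (at t within I)"
    and "times_differentiable_on n I (\<lambda>t. vector_derivative f (at t within I))"
proof -
  from assms(1) obtain f' where f': "\<forall>t\<in>I. (f has_vector_derivative f' t) (at t within I)"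
    "times_differentiable_on n I f'" by auto
  have eq: "f' t = vector_derivative f (at t within I)" if "t \<in> I" for t
    using vector_derivative_within[OF _ f'(1)[rule_format, OF that]] perf[OF that] trivial_limit_within
    by metis
  show "t \<in> I \<Longrightarrow> (f has_vector_derivative vector_derivative f (at t within I)) (at t within I)"
    using f'(1) eq by auto
  show "times_differentiable_on n I (\<lambda>t. vector_derivative f (at t within I))"
    using times_differentiable_on_cong[OF f'(2) eq] .
qed

text \<open>The iterated derivatives witness smoothness: at points of a set without isolated points
  derivatives are unique, so the functions that witness finite differentiability to different
  orders fit together.\<close>

lemma times_differentiable_on_imp_smooth_on:
  assumes "\<And>n. times_differentiable_on n I f" and perf: "\<And>t. t \<in> I \<Longrightarrow> t islimpt I"
  shows "smooth_on I f"
proof -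
  define F where "F n = ((\<lambda>g t. vector_derivative g (at t within I)) ^^ n) f" for n :: nat
  have F: "times_differentiable_on m I (F n)" for m n
  proof (induction n arbitrary: m)
    case 0
    then show ?case using assms(1) by (simp add: F_def)
  next
    case (Suc n)
    show ?case using vector_derivative_times_differentiable_on(2)[OF Suc perf] by (simp add: F_def)
  qed
  have "(F n has_vector_derivative F (Suc n) t) (at t within I)" if "t \<in> I" for n t
    using vector_derivative_times_differentiable_on(1)[OF F perf that] by (simp add: F_def)
  then show ?thesis unfolding smooth_on_def
    by (intro exI[of _ F]) (auto simp: F_def)
qed

text \<open>Derivatives within \<open>I\<close> and within \<open>I \<inter> U\<close> agree at points of the open set \<open>U\<close>, and as they
  are unique, the local derivatives are all restrictions of one global function.\<close>

lemma times_differentiable_on_locally: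
  assumes perf: "\<And>t. t \<in> I \<Longrightarrow> t islimpt I"
    and loc: "\<And>t. t \<in> I \<Longrightarrow> \<exists>U. open U \<and> t \<in> U \<and> times_differentiable_on n (I \<inter> U) f"
  shows "times_differentiable_on n I f"
  using loc
proof (induction n arbitrary: f)
  case (Suc n)
  have *: "\<exists>U. open U \<and> t \<in> U \<and>
      times_differentiable_on n (I \<inter> U) (\<lambda>t. vector_derivative f (at t within I)) \<and>
      (f has_vector_derivative vector_derivative f (at t within I)) (at t within I)"
    if t: "t \<in> I" for t
  proof -
    from Suc.prems[OF t] obtain U f' where U: "open U" "t \<in> U"
      "\<forall>t\<in>I\<inter>U. (f has_vector_derivative f' t) (at t within I\<inter>U)" "times_differentiable_on n (I\<inter>U) f'"
      by auto
    have f': "(f has_vector_derivative f' s) (at s within I)" if "s \<in> I \<inter> U" for s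
    proof -
      have "at s within (I \<inter> U) = at s within I"
        using that U(1) by (intro at_within_nhd[of _ U]) auto
      then show ?thesis using U(3) that by metis
    qed
    have eq: "f' s = vector_derivative f (at s within I)" if "s \<in> I \<inter> U" for s
      using vector_derivative_within[OF _ f'[OF that]] perf that trivial_limit_within
      by (metis IntD1)
    show ?thesis using times_differentiable_on_cong[OF U(4) eq] f'[of t] eq[of t] U(1,2) t by auto
  qed
  show ?case
    by (rule times_differentiable_on_SucI[of _ _ "\<lambda>t. vector_derivative f (at t within I)"])
       (use * in blast, rule Suc.IH, use * in blast)
qed simp

lemma times_differentiable_on_const: "times_differentiable_on n I (\<lambda>_. c)"
proof (induction n arbitrary: c)
  case (Suc n)
  show ?case using Suc[of 0] by (auto intro!: exI[of _ "\<lambda>_. 0"])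
qed simp

lemma times_differentiable_on_ident: "times_differentiable_on n I (\<lambda>t. t)"
  by (cases n) (auto intro!: exI[of _ "\<lambda>_. 1"] times_differentiable_on_const)

lemma times_differentiable_on_add:
  "times_differentiable_on n I f \<Longrightarrow> times_differentiable_on n I g \<Longrightarrow>
   times_differentiable_on n I (\<lambda>t. f t + g t)"
proof (induction n arbitrary: f g)
  case (Suc n)
  from Suc.prems obtain f' g' where
    "\<forall>t\<in>I. (f has_vector_derivative f' t) (at t within I)" "times_differentiable_on n I f'"
    "\<forall>t\<in>I. (g has_vector_derivative g' t) (at t within I)" "times_differentiable_on n I g'"
    by auto
  with Suc.IH show ?case
    by (auto intro!: exI[of _ "\<lambda>t. f' t + g' t"] has_vector_derivative_add)
qed simp

lemma times_differentiable_on_bilinear: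
  assumes "bounded_bilinear B"
  shows "times_differentiable_on n I f \<Longrightarrow> times_differentiable_on n I g \<Longrightarrow>
   times_differentiable_on n I (\<lambda>t. B (f t) (g t))"
proof (induction n arbitrary: f g)
  case (Suc n)
  from Suc.prems obtain f' g' where *:
    "\<forall>t\<in>I. (f has_vector_derivative f' t) (at t within I)" "times_differentiable_on n I f'"
    "\<forall>t\<in>I. (g has_vector_derivative g' t) (at t within I)" "times_differentiable_on n I g'"
    by auto
  have "((\<lambda>t. B (f t) (g t)) has_vector_derivative B (f t) (g' t) + B (f' t) (g t))
      (at t within I)" if "t \<in> I" for t
    using bounded_bilinear.has_vector_derivative[OF assms] * that by blast
  moreover have "times_differentiable_on n I (\<lambda>t. B (f t) (g' t) + B (f' t) (g t))"
    using Suc.prems[THEN times_differentiable_on_Suc_D] * Suc.IH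
    by (intro times_differentiable_on_add) auto
  ultimately show ?case by (rule times_differentiable_on_SucI)
qed simp

lemmas times_differentiable_on_scaleR = times_differentiable_on_bilinear[OF bounded_bilinear_scaleR]
lemmas times_differentiable_on_mult = times_differentiable_on_bilinear[OF bounded_bilinear_mult]

lemma times_differentiable_on_minus:
  "times_differentiable_on n I f \<Longrightarrow> times_differentiable_on n I (\<lambda>t. - f t)"
  using times_differentiable_on_scaleR[OF times_differentiable_on_const[of n I "-1"], of f] by simp

lemma times_differentiable_on_diff:
  "times_differentiable_on n I f \<Longrightarrow> times_differentiable_on n I g \<Longrightarrow>
   times_differentiable_on n I (\<lambda>t. f t - g t)"
  using times_differentiable_on_add[OF _ times_differentiable_on_minus, of n I f g] by simp

lemma times_differentiable_on_compose:
  "times_differentiable_on n J g \<Longrightarrow> times_differentiable_on n I h \<Longrightarrow> h ` I \<subseteq> J \<Longrightarrow>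
   times_differentiable_on n I (\<lambda>t. g (h t))"
proof (induction n arbitrary: g)
  case (Suc n)
  from Suc.prems obtain g' h' where *:
    "\<forall>t\<in>J. (g has_vector_derivative g' t) (at t within J)" "times_differentiable_on n J g'"
    "\<forall>t\<in>I. (h has_vector_derivative h' t) (at t within I)" "times_differentiable_on n I h'"
    by auto
  have "((\<lambda>t. g (h t)) has_vector_derivative h' t *\<^sub>R g' (h t)) (at t within I)" if "t \<in> I" for t
  proof -
    have "h t \<in> J" using that Suc.prems(3) by auto
    then have "(g has_vector_derivative g' (h t)) (at (h t) within h ` I)"
      using *(1) Suc.prems(3) has_vector_derivative_within_subset by blast
    from vector_diff_chain_within[OF *(3)[rule_format, OF that] this]
    show ?thesis by (simp add: o_def)
  qed
  moreover have "times_differentiable_on n I (\<lambda>t. h' t *\<^sub>R g' (h t))"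
    by (intro times_differentiable_on_scaleR *(4) Suc.IH *(2) Suc.prems(3)
        times_differentiable_on_Suc_D[OF Suc.prems(2)])
  ultimately show ?case by (rule times_differentiable_on_SucI)
qed simp

lemma times_differentiable_on_inverse:
  fixes f :: "real \<Rightarrow> real"
  assumes "\<And>t. t \<in> I \<Longrightarrow> f t \<noteq> 0"
  shows "times_differentiable_on n I f \<Longrightarrow> times_differentiable_on n I (\<lambda>t. inverse (f t))"
proof (induction n)
  case (Suc n)
  from Suc.prems obtain f' where *:
    "\<forall>t\<in>I. (f has_vector_derivative f' t) (at t within I)" "times_differentiable_on n I f'"
    by auto
  have "((\<lambda>t. inverse (f t)) has_vector_derivative - (f' t * (inverse (f t) * inverse (f t)))) (at t within I)"
    if "t \<in> I" for t
    using * assms that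
    by (auto simp flip: has_real_derivative_iff_has_vector_derivative intro!: derivative_eq_intros)
  moreover have "times_differentiable_on n I (\<lambda>t. - (f' t * (inverse (f t) * inverse (f t))))"
    by (intro times_differentiable_on_minus times_differentiable_on_mult * Suc.IH
        times_differentiable_on_Suc_D[OF Suc.prems])
  ultimately show ?case by (rule times_differentiable_on_SucI)
qed simp

lemma times_differentiable_on_divide:
  fixes f g :: "real \<Rightarrow> real"
  assumes "\<And>t. t \<in> I \<Longrightarrow> g t \<noteq> 0" "times_differentiable_on n I f" "times_differentiable_on n I g"
  shows "times_differentiable_on n I (\<lambda>t. f t / g t)"
  using times_differentiable_on_mult[OF assms(2) times_differentiable_on_inverse[OF assms(1,3)]]
  by (simp add: divide_inverse)

text \<open>The equation \<open>k' = inverse (f' \<circ> k)\<close> carries smoothness of \<open>f'\<close> over to \<open>k\<close>, one order at a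
  time.\<close>

lemma times_differentiable_on_inverse_function:
  fixes f f' :: "real \<Rightarrow> real"
  assumes f': "\<And>n. times_differentiable_on n U f'"
    and nz: "\<And>s. s \<in> U \<Longrightarrow> f' s \<noteq> 0"
    and k: "\<And>y. y \<in> W \<Longrightarrow> (k has_real_derivative inverse (f' (k y))) (at y)"
    and kU: "k ` W \<subseteq> U"
  shows "times_differentiable_on n W k"
proof (induction n)
  case (Suc n)
  have "times_differentiable_on n W (\<lambda>y. inverse (f' (k y)))"
    using kU nz by (intro times_differentiable_on_inverse times_differentiable_on_compose[OF f' Suc kU]) auto
  then show ?case
    by (rule times_differentiable_on_SucI[rotated])
       (auto simp flip: has_real_derivative_iff_has_vector_derivative
          intro!: has_field_derivative_at_within k)
qed simp

lemma local_smooth_inverse: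
  fixes f f' :: "real \<Rightarrow> real"
  assumes "open U" "s0 \<in> U"
    and f: "\<And>s. s \<in> U \<Longrightarrow> (f has_real_derivative f' s) (at s)"
    and f': "\<And>n. times_differentiable_on n U f'"
    and nz: "\<And>s. s \<in> U \<Longrightarrow> f' s \<noteq> 0"
  obtains W k where "open W" "f s0 \<in> W" "k (f s0) = s0" "k ` W \<subseteq> U"
    "\<And>y. y \<in> W \<Longrightarrow> f (k y) = y" "\<And>y. y \<in> W \<Longrightarrow> k differentiable (at y)"
    "\<And>n. times_differentiable_on n W k"
proof -
  let ?f' = "\<lambda>s. blinfun_mult_right (f' s)"
  from f'[of "Suc 0"] have "continuous_on U f'"
    by (auto simp: continuous_on_eq_continuous_within intro: has_vector_derivative_continuous)
  then have cont: "continuous_on U ?f'"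
    by (intro bounded_linear.continuous_on[OF bounded_linear_blinfun_mult_right])
  have inv: "blinfun_mult_right (inverse (f' s0)) o\<^sub>L ?f' s0 = id_blinfun"
    using nz[OF assms(2)] by (intro blinfun_eqI) auto
  have der: "(f has_derivative blinfun_apply (?f' s)) (at s)" if "s \<in> U" for s
    using f[OF that] by (simp add: has_field_derivative_def)
  obtain U' W k k' where *: "open U'" "U' \<subseteq> U" "s0 \<in> U'" "open W" "f s0 \<in> W" "homeomorphism U' W f k"
    "\<And>y. y \<in> W \<Longrightarrow> (k has_derivative (k' y)) (at y)"
    "\<And>y. y \<in> W \<Longrightarrow> k' y = inv (blinfun_apply (?f' (k y)))"
    using inverse_function_theorem[OF assms(1) der cont assms(2) inv] by metis
  have kU: "k ` W \<subseteq> U" using *(2,6) by (auto simp: homeomorphism_def)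
  have "(k has_real_derivative inverse (f' (k y))) (at y)" if "y \<in> W" for y
  proof -
    have "f' (k y) \<noteq> 0" using kU nz that by auto
    then have "inv ((*) (f' (k y))) = (*) (inverse (f' (k y)))"
      by (intro inv_unique_comp) (auto simp: fun_eq_iff)
    then show ?thesis using *(7,8)[OF that] by (simp add: has_field_derivative_def)
  qed
  from times_differentiable_on_inverse_function[OF f' nz this kU]
  have "times_differentiable_on n W k" for n .
  with *(3,4,5,6,7) kU show thesis
    by (intro that[of W k]) (auto simp: homeomorphism_def differentiable_def)
qed

section \<open>Coordinates on a normed plane\<close>

text \<open>Norms on a plane are equivalent: the norm attains a positive minimum on the Euclidean unit
  circle. The abstract plane is not an instance of the class of Euclidean spaces, so boundedness
  of bilinear forms and compactness of the unit circle are transported along such a coordinate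
  map.\<close>

lemma normed_plane_coordinates:
  assumes "dim (UNIV :: 'a::real_normed_vector set) = 2"
  obtains T :: "real \<times> real \<Rightarrow> 'a::real_normed_vector" and m where
    "bounded_linear T" "surj T" "0 < m" "\<And>z. m * norm z \<le> norm (T z)"
proof -
  obtain B :: "'a set" where B: "independent B" "UNIV \<subseteq> span B" "card B = 2"
    using assms basis_exists[of "UNIV :: 'a set"] by metis
  from B(3) obtain e1 e2 where e: "B = {e1, e2}" "e1 \<noteq> e2"
    by (meson card_2_iff)
  define T where "T z = fst z *\<^sub>R e1 + snd z *\<^sub>R e2" for z :: "real \<times> real"
  have T: "bounded_linear T" unfolding T_def by (intro bounded_linear_intros)
  have surj: "surj T"
  proof -
    have "\<exists>z. x = T z" for x
    proof -
      have "x \<in> span {e1, e2}" using B(2) e by auto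
      then obtain a b where "x = a *\<^sub>R e1 + b *\<^sub>R e2"
        unfolding span_insert[of e1] span_singleton by (auto simp: algebra_simps)
      then show ?thesis unfolding T_def by (intro exI[of _ "(a, b)"]) auto
    qed
    then show ?thesis unfolding surj_def by blast
  qed
  have nz: "T z \<noteq> 0" if "z \<noteq> 0" for z
  proof
    assume 0: "T z = 0"
    have ne: "e1 \<notin> span {e2}" "e2 \<notin> span {e1}"
      using B(1) e by (auto simp: dependent_def insert_Diff_if)
    show False
    proof (cases "fst z = 0")
      case True
      then have "snd z \<noteq> 0" using that by (metis prod.collapse zero_prod_def)
      then have "e2 = 0" using 0 True unfolding T_def by simp
      then show False using ne(2) span_zero by blast
    next
      case False
      have "fst z *\<^sub>R e1 = - (snd z *\<^sub>R e2)" using 0 unfolding T_def by (simp add: eq_neg_iff_add_eq_0)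
      then have "e1 = (- snd z / fst z) *\<^sub>R e2"
        using False by (metis divideR_right divide_inverse_commute scaleR_minus_left scaleR_scaleR)
      then show False using ne(1) span_breakdown_eq span_singleton by blast
    qed
  qed
  have "continuous_on (sphere 0 1) (\<lambda>z. norm (T z))"
    using bounded_linear.continuous_on[OF T continuous_on_id] by (intro continuous_on_norm)
  then obtain z0 where z0: "z0 \<in> sphere 0 1" "\<forall>z\<in>sphere 0 1. norm (T z0) \<le> norm (T z)"
    using continuous_attains_inf[of "sphere (0::real \<times> real) 1" "\<lambda>z. norm (T z)"] by auto
  have "norm (T z0) * norm z \<le> norm (T z)" for z
  proof (cases "z = 0")
    case False
    have "norm (T z0) \<le> norm (T (z /\<^sub>R norm z))" using z0(2) False by auto
    also have "\<dots> = norm (T z) / norm z"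
      by (simp add: linear_simps(5)[OF T] divide_inverse_commute)
    finally show ?thesis using False by (simp add: field_simps)
  qed (simp add: linear_simps(3)[OF T])
  moreover have "norm (T z0) > 0" using nz[of z0] z0(1) by (cases "z0 = 0") auto
  ultimately show thesis using that T surj by blast
qed

section \<open>Birkhoff orthogonality\<close>

lemma birkhoff_orth_scaleR:
  assumes "birkhoff_orth x y"
  shows "birkhoff_orth (a *\<^sub>R x) (b *\<^sub>R y)"
proof (cases "a = 0")
  case False
  have "norm (a *\<^sub>R x) \<le> norm (a *\<^sub>R x + t *\<^sub>R b *\<^sub>R y)" for t
  proof -
    have "norm x \<le> norm (x + (t * b / a) *\<^sub>R y)" using assms by (simp add: birkhoff_orth_def)
    then have "norm (a *\<^sub>R x) \<le> norm (a *\<^sub>R (x + (t * b / a) *\<^sub>R y))"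
      by (simp add: mult_left_mono)
    also have "a *\<^sub>R (x + (t * b / a) *\<^sub>R y) = a *\<^sub>R x + t *\<^sub>R b *\<^sub>R y"
      using False by (simp add: scaleR_add_right)
    finally show ?thesis .
  qed
  then show ?thesis by (simp add: birkhoff_orth_def)
qed (simp add: birkhoff_orth_def)

text \<open>If the tangent line entered the open unit ball, then by convexity the norm would drop below
  \<open>1\<close> at a linear rate along it, whereas the curve leaves its tangent line only by
  \<open>o(\<bar>u - s\<bar>)\<close>.\<close>

lemma birkhoff_orth_tangent:
  assumes der: "(c has_vector_derivative c') (at s)" and unit: "\<And>u. norm (c u) = 1"
  shows "birkhoff_orth (c s) c'"
proof (rule ccontr)
  assume "\<not> ?thesis"
  then obtain t where t: "norm (c s + t *\<^sub>R c') < 1"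
    unfolding birkhoff_orth_def unit by (auto simp: not_le)
  define q where "q = 1 - norm (c s + t *\<^sub>R c')"
  have q: "q > 0" using t by (simp add: q_def)
  have t0: "t \<noteq> 0" using t unit[of s] by auto
  \<comment> \<open>the step \<open>u t\<close> along the line lowers the norm by at least \<open>u q\<close>; \<open>e\<close> keeps the error below half of that\<close>
  define e where "e = q / (2 * \<bar>t\<bar>)"
  have e: "e > 0" using q t0 by (simp add: e_def)
  obtain d where d: "d > 0"
    "\<And>y. norm (y - s) < d \<Longrightarrow> norm (c y - c s - (y - s) *\<^sub>R c') \<le> e * norm (y - s)"
    using der e unfolding has_vector_derivative_def has_derivative_at_alt by metis
  define u where "u = min (1/2) (d / (2 * \<bar>t\<bar>))"
  have u: "0 < u" "u < 1" "u * \<bar>t\<bar> < d"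
  proof -
    show "0 < u" "u < 1" using d(1) t0 by (auto simp: u_def)
    have "u * \<bar>t\<bar> \<le> d / (2 * \<bar>t\<bar>) * \<bar>t\<bar>" by (intro mult_right_mono) (auto simp: u_def)
    also have "\<dots> < d" using t0 d(1) by simp
    finally show "u * \<bar>t\<bar> < d" .
  qed
  let ?r = "c (s + u * t) - c s - (u * t) *\<^sub>R c'"
  have "norm ?r \<le> e * \<bar>u * t\<bar>"
    using d(2)[of "s + u * t"] u by (simp add: abs_mult)
  also have "\<dots> = u * q / 2" using u t0 by (simp add: e_def abs_mult)
  finally have r: "norm ?r \<le> u * q / 2" .
  have "c (s + u * t) = (1 - u) *\<^sub>R c s + u *\<^sub>R (c s + t *\<^sub>R c') + ?r"
    by (simp add: algebra_simps)
  then have "norm (c (s + u * t)) \<le> norm ((1 - u) *\<^sub>R c s) + norm (u *\<^sub>R (c s + t *\<^sub>R c')) + norm ?r"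
    by (metis norm_add_rule_thm order_refl norm_triangle_ineq add_mono norm_triangle_mono)
  also have "\<dots> \<le> (1 - u) + u * (1 - q) + u * q / 2"
    using r u unit[of s] by (simp add: q_def)
  also have "\<dots> < 1" using u q by (simp add: algebra_simps)
  finally show False using unit by simp
qed

lemma birkhoff_map_scaleR:
  assumes "bilinear \<omega>" "r > 0"
  shows "birkhoff_map \<omega> (r *\<^sub>R v) = birkhoff_map \<omega> v"
proof -
  have "birkhoff_orth (r *\<^sub>R v) w \<longleftrightarrow> birkhoff_orth v w" for w
    using birkhoff_orth_scaleR[of v w r 1] birkhoff_orth_scaleR[of "r *\<^sub>R v" w "inverse r" 1] assms by auto
  moreover have "\<omega> (r *\<^sub>R v) w > 0 \<longleftrightarrow> \<omega> v w > 0" for w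
    using assms by (simp add: bilinear_lmul zero_less_mult_iff)
  ultimately show ?thesis by (simp add: birkhoff_map_def)
qed

section \<open>The Birkhoff map of a smooth plane\<close>

locale smooth_plane =
  fixes \<omega> :: "'a::real_normed_vector \<Rightarrow> 'a \<Rightarrow> real"
  assumes dim2: "dim (UNIV :: 'a set) = 2"
    and smooth_sphere: "smooth_closed_curve (sphere (0::'a) 1)"
    and symplectic: "symplectic_form \<omega>"
begin

lemma bilinear: "bilinear \<omega>" and alternating: "\<omega> x x = 0"
  and nondegenerate: "(\<And>y. \<omega> x y = 0) \<Longrightarrow> x = 0"
  using symplectic by (auto simp: symplectic_form_def)

lemma skew: "\<omega> x y = - \<omega> y x"
  using alternating[of "x + y"] alternating[of x] alternating[of y]
  by (simp add: bilinear_ladd[OF bilinear] bilinear_radd[OF bilinear])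

lemma coordinates:
  obtains T :: "real \<times> real \<Rightarrow> 'a" and m where
    "bounded_linear T" "surj T" "0 < m" "\<And>z. m * norm z \<le> norm (T z)"
    "\<And>z w. \<omega> (T z) (T w) = (fst z * snd w - snd z * fst w) * \<omega> (T (1, 0)) (T (0, 1))"
proof -
  obtain T :: "real \<times> real \<Rightarrow> 'a" and m where T: "bounded_linear T" "surj T" "0 < m"
    "\<And>z. m * norm z \<le> norm (T z)" using normed_plane_coordinates[OF dim2] by blast
  have *: "T z = fst z *\<^sub>R T (1, 0) + snd z *\<^sub>R T (0, 1)" for z
    using linear_simps(1)[OF T(1), of "fst z *\<^sub>R (1, 0)" "snd z *\<^sub>R (0, 1)"]
    by (simp only: linear_simps(5)[OF T(1)]) simp
  have "\<omega> (T z) (T w) = (fst z * snd w - snd z * fst w) * \<omega> (T (1, 0)) (T (0, 1))" for z w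
    using skew[of "T (0, 1)" "T (1, 0)"]
    by (subst *[of z], subst *[of w])
       (simp add: bilinear_ladd[OF bilinear] bilinear_radd[OF bilinear] bilinear_lmul[OF bilinear]
        bilinear_rmul[OF bilinear] alternating algebra_simps)
  with T that show thesis by blast
qed

sublocale omega: bounded_bilinear \<omega>
proof -
  obtain T :: "real \<times> real \<Rightarrow> 'a" and m where T: "bounded_linear T" "surj T" "0 < m"
    "\<And>z. m * norm z \<le> norm (T z)"
    "\<And>z w. \<omega> (T z) (T w) = (fst z * snd w - snd z * fst w) * \<omega> (T (1, 0)) (T (0, 1))"
    using coordinates by blast
  let ?D = "\<bar>\<omega> (T (1, 0)) (T (0, 1))\<bar>"
  have "norm (\<omega> x y) \<le> norm x * norm y * (2 * ?D / m\<^sup>2)" for x y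
  proof -
    obtain z w where zw: "x = T z" "y = T w" using T(2) by (metis surjD)
    have bound: "\<bar>fst v\<bar> \<le> norm (T v) / m \<and> \<bar>snd v\<bar> \<le> norm (T v) / m" for v
    proof -
      have "norm v \<le> norm (T v) / m" using T(3) T(4)[of v] by (simp add: field_simps)
      moreover have "\<bar>fst v\<bar> \<le> norm v" "\<bar>snd v\<bar> \<le> norm v"
        using norm_fst_le[of "fst v" "snd v"] norm_snd_le[of "snd v" "fst v"] by auto
      ultimately show ?thesis by linarith
    qed
    have z: "\<bar>fst z\<bar> \<le> norm x / m" "\<bar>snd z\<bar> \<le> norm x / m"
      and w: "\<bar>fst w\<bar> \<le> norm y / m" "\<bar>snd w\<bar> \<le> norm y / m"
      using bound[of z] bound[of w] by (auto simp: zw)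
    have "\<bar>fst z * snd w - snd z * fst w\<bar> \<le> \<bar>fst z\<bar> * \<bar>snd w\<bar> + \<bar>snd z\<bar> * \<bar>fst w\<bar>"
      by (metis abs_mult abs_triangle_ineq4)
    also have "\<dots> \<le> norm x / m * (norm y / m) + norm x / m * (norm y / m)"
      using z w T(3) by (intro add_mono mult_mono) auto
    finally have "\<bar>fst z * snd w - snd z * fst w\<bar> * ?D \<le> (norm x / m * (norm y / m) + norm x / m * (norm y / m)) * ?D"
      by (intro mult_right_mono) auto
    also have "(norm x / m * (norm y / m) + norm x / m * (norm y / m)) * ?D = norm x * norm y * (2 * ?D / m\<^sup>2)"
      by (simp add: power2_eq_square)
    also have "\<bar>fst z * snd w - snd z * fst w\<bar> * ?D = norm (\<omega> x y)"
      unfolding zw T(5)[of z w] by (simp only: abs_mult real_norm_def)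
    finally show ?thesis .
  qed
  then show "bounded_bilinear \<omega>"
    using bilinear
    by (intro bounded_bilinear.intro exI[of _ "2 * ?D / m\<^sup>2"])
       (auto simp: bilinear_ladd bilinear_radd bilinear_lmul bilinear_rmul)
qed

lemma compact_unit_sphere: "compact (sphere (0::'a) 1)"
proof -
  obtain T :: "real \<times> real \<Rightarrow> 'a" and m where T: "bounded_linear T" "surj T" "0 < m"
    "\<And>z. m * norm z \<le> norm (T z)" using coordinates by metis
  have cont: "continuous_on A T" for A
    using bounded_linear.continuous_on[OF T(1) continuous_on_id] .
  let ?A = "cball 0 (1 / m) \<inter> T -` sphere 0 1"
  have "compact ?A"
    by (intro compact_Int_closed compact_cball closed_vimage cont)
       (simp add: sphere_def dist_norm closed_Collect_eq continuous_on_norm continuous_on_id)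
  moreover have "T ` ?A = sphere 0 1"
  proof (intro equalityI subsetI)
    fix x :: 'a assume x: "x \<in> sphere 0 1"
    obtain z where z: "x = T z" using T(2) by (metis surjD)
    have "norm z \<le> 1 / m" using T(3) T(4)[of z] x z by (simp add: field_simps)
    then show "x \<in> T ` ?A" using x z by auto
  qed auto
  ultimately show ?thesis using compact_continuous_image[OF cont] by metis
qed

text \<open>Three vectors of a plane are dependent; the coefficients of the dependence are Cramer's
  determinants.\<close>

lemma three_term: "\<omega> x y *\<^sub>R z + \<omega> y z *\<^sub>R x + \<omega> z x *\<^sub>R y = 0"
proof -
  obtain T :: "real \<times> real \<Rightarrow> 'a" where T: "bounded_linear T" "surj T"
    "\<And>z w. \<omega> (T z) (T w) = (fst z * snd w - snd z * fst w) * \<omega> (T (1, 0)) (T (0, 1))"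
    using coordinates by metis
  obtain a b c where abc: "x = T a" "y = T b" "z = T c" using T(2) by (metis surjD)
  let ?D = "\<omega> (T (1, 0)) (T (0, 1))"
  have "\<omega> x y *\<^sub>R z + \<omega> y z *\<^sub>R x + \<omega> z x *\<^sub>R y =
     T (((fst a * snd b - snd a * fst b) * ?D) *\<^sub>R c + ((fst b * snd c - snd b * fst c) * ?D) *\<^sub>R a
       + ((fst c * snd a - snd c * fst a) * ?D) *\<^sub>R b)"
    unfolding abc T(3)[of a b] T(3)[of b c] T(3)[of c a] by (simp add: linear_simps[OF T(1)])
  also have "((fst a * snd b - snd a * fst b) * ?D) *\<^sub>R c + ((fst b * snd c - snd b * fst c) * ?D) *\<^sub>R a
       + ((fst c * snd a - snd c * fst a) * ?D) *\<^sub>R b = 0"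
    by (auto simp: prod_eq_iff algebra_simps)
  finally show ?thesis by (simp add: linear_simps[OF T(1)])
qed

lemma decomposition:
  assumes "\<omega> x y \<noteq> 0"
  shows "z = (\<omega> z y / \<omega> x y) *\<^sub>R x + (\<omega> x z / \<omega> x y) *\<^sub>R y"
proof -
  have "\<omega> x y *\<^sub>R z = \<omega> z y *\<^sub>R x + \<omega> x z *\<^sub>R y"
    using three_term[of x y z] skew[of z x] skew[of y z] by (simp add: algebra_simps)
  then have "(1 / \<omega> x y) *\<^sub>R \<omega> x y *\<^sub>R z = (1 / \<omega> x y) *\<^sub>R (\<omega> z y *\<^sub>R x + \<omega> x z *\<^sub>R y)" by simp
  then show ?thesis using assms by (simp add: scaleR_add_right)
qed

lemma parallel:
  assumes "\<omega> x y = 0" "x \<noteq> 0"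
  obtains r where "y = r *\<^sub>R x"
proof -
  obtain z where "\<omega> x z \<noteq> 0" using nondegenerate assms(2) by blast
  from decomposition[OF this, of y] assms(1) show thesis using that by simp
qed

lemma birkhoff_orth_independent:
  assumes "birkhoff_orth x w" "x \<noteq> 0" "w \<noteq> 0"
  shows "\<omega> x w \<noteq> 0"
proof
  assume "\<omega> x w = 0"
  then obtain r where r: "w = r *\<^sub>R x" using parallel assms(2) by blast
  then have "r \<noteq> 0" using assms(3) by auto
  then have "x + (- 1 / r) *\<^sub>R w = 0" by (simp add: r)
  then show False using assms(1,2) unfolding birkhoff_orth_def
    by (metis norm_le_zero_iff norm_zero)
qed

text \<open>Up to scaling, \<open>\<omega> _ w\<close> is the linear functional that supports the unit ball at \<open>x\<close>: it
  vanishes in the direction \<open>w\<close>, and \<open>y\<close> is a multiple of a point \<open>x + t w\<close> of the supporting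
  line.\<close>

lemma birkhoff_orth_support:
  assumes "birkhoff_orth x w"
  shows "\<bar>\<omega> y w\<bar> * norm x \<le> \<bar>\<omega> x w\<bar> * norm y"
proof (cases "\<omega> y w = 0 \<or> \<omega> x w = 0")
  case True
  have "\<omega> y w = 0" if "x \<noteq> 0" using True
  proof
    assume "\<omega> x w = 0"
    with birkhoff_orth_independent[OF assms that] have "w = 0" by blast
    then show ?thesis by (simp add: omega.zero_right)
  qed auto
  then show ?thesis by (cases "x = 0") auto
next
  case False
  define a where "a = \<omega> y w / \<omega> x w"
  have a: "a \<noteq> 0" using False by (simp add: a_def)
  have "y = a *\<^sub>R (x + ((\<omega> x y / \<omega> x w) / a) *\<^sub>R w)"
    using decomposition[of x w y] False a by (simp add: scaleR_add_right flip: a_def)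
  moreover have "norm x \<le> norm (x + ((\<omega> x y / \<omega> x w) / a) *\<^sub>R w)"
    using assms unfolding birkhoff_orth_def by blast
  ultimately have "\<bar>a\<bar> * norm x \<le> norm y"
    by (metis abs_ge_zero mult_left_mono norm_scaleR)
  then show ?thesis using False by (simp add: a_def field_simps)
qed

text \<open>A tangent vector is Birkhoff orthogonal to its base point and hence independent of it, so
  \<open>\<omega> (c s) (c' s)\<close> has constant sign, and reversing the parameter makes it positive.\<close>

lemma unit_circle_parametrization:
  obtains c c' :: "real \<Rightarrow> 'a" where
    "\<And>n. times_differentiable_on n UNIV c" "\<And>n. times_differentiable_on n UNIV c'"
    "\<And>s. (c has_vector_derivative c' s) (at s)" "\<And>s. \<omega> (c s) (c' s) > 0"
    "range c = sphere 0 1"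
proof -
  have "\<exists>c :: real \<Rightarrow> 'a. smooth_on UNIV c \<and> (\<forall>s. vector_derivative c (at s) \<noteq> 0) \<and> range c = sphere 0 1"
    using smooth_sphere[unfolded smooth_closed_curve_def]
    by (elim exE conjE, intro exI conjI) assumption+
  then obtain c :: "real \<Rightarrow> 'a" where c: "smooth_on UNIV c" "\<And>s. vector_derivative c (at s) \<noteq> 0"
    "range c = sphere 0 1" by auto
  define c' where "c' s = vector_derivative c (at s)" for s
  have cn: "times_differentiable_on n UNIV c" for n
    using smooth_on_imp_times_differentiable_on[OF c(1)] .
  have c'n: "times_differentiable_on n UNIV c'" for n
    using vector_derivative_times_differentiable_on(2)[OF cn] by (simp add: islimpt_UNIV c'_def[abs_def])
  have der: "(c has_vector_derivative c' s) (at s)" for s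
    using vector_derivative_times_differentiable_on(1)[OF cn, of s] by (simp add: islimpt_UNIV c'_def)
  have unit: "norm (c s) = 1" for s using c(3) by auto
  have nz: "\<omega> (c s) (c' s) \<noteq> 0" for s
    using birkhoff_orth_tangent[OF der unit] c(2)[of s] unit[of s]
    by (intro birkhoff_orth_independent) (auto simp: c'_def)
  have "continuous_on UNIV (\<lambda>s. \<omega> (c s) (c' s))"
  proof (intro omega.continuous_on)
    show "continuous_on UNIV c" using der
      by (auto simp: continuous_on_eq_continuous_within intro: has_vector_derivative_continuous)
    show "continuous_on UNIV c'" using c'n[of "Suc 0"]
      by (auto simp: continuous_on_eq_continuous_within intro: has_vector_derivative_continuous)
  qed
  then have conn: "connected (range (\<lambda>s. \<omega> (c s) (c' s)))"
    by (intro connected_continuous_image) auto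
  consider "\<And>s. \<omega> (c s) (c' s) > 0" | "\<And>s. \<omega> (c s) (c' s) < 0"
  proof (cases "\<exists>s u. \<omega> (c s) (c' s) < 0 \<and> \<omega> (c u) (c' u) > 0")
    case True
    then obtain s u where "\<omega> (c s) (c' s) < 0" "\<omega> (c u) (c' u) > 0" by blast
    then have "0 \<in> range (\<lambda>s. \<omega> (c s) (c' s))"
      using connectedD_interval[OF conn, of "\<omega> (c s) (c' s)" "\<omega> (c u) (c' u)" 0] by simp
    then obtain r where "\<omega> (c r) (c' r) = 0" by fastforce
    then show thesis using nz[of r] by contradiction
  next
    case False
    show thesis
    proof (cases "\<omega> (c 0) (c' 0) > 0")
      case True
      with False have "\<not> \<omega> (c s) (c' s) < 0" for s by blast
      with nz have "\<omega> (c s) (c' s) > 0" for s by (metis linorder_neqE_linordered_idom)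
      then show thesis using that(1) by blast
    next
      case 0: False
      with nz[of 0] have "\<omega> (c 0) (c' 0) < 0" by linarith
      with False have "\<not> \<omega> (c s) (c' s) > 0" for s by blast
      with nz have "\<omega> (c s) (c' s) < 0" for s by (metis linorder_neqE_linordered_idom)
      then show thesis using that(2) by blast
    qed
  qed
  then show thesis
  proof cases
    case 1
    then show thesis using that cn c'n der c(3) by blast
  next
    case 2
    have m: "times_differentiable_on n UNIV (uminus :: real \<Rightarrow> real)" for n
      using times_differentiable_on_minus[OF times_differentiable_on_ident] .
    show thesis
    proof (rule that[of "\<lambda>s. c (- s)" "\<lambda>s. - c' (- s)"])
      show "times_differentiable_on n UNIV (\<lambda>s. c (- s))" for n
        using times_differentiable_on_compose[OF cn m] by simp
      show "times_differentiable_on n UNIV (\<lambda>s. - c' (- s))" for n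
        using times_differentiable_on_minus[OF times_differentiable_on_compose[OF c'n m]] by simp
      show "((\<lambda>s. c (- s)) has_vector_derivative - c' (- s)) (at s)" for s
        using vector_diff_chain_at[OF has_vector_derivative_minus[OF has_vector_derivative_id] der]
        by (simp add: o_def)
      show "0 < \<omega> (c (- s)) (- c' (- s))" for s using 2[of "- s"] by (simp add: omega.minus_right)
      have "range (\<lambda>s. c (- s)) = range c"
        by (metis (no_types) image_image surj_uminus)
      then show "range (\<lambda>s. c (- s)) = sphere 0 1" using c(3) by simp
    qed
  qed
qed

text \<open>Existence comes from the tangent vector. Uniqueness holds because the functional supporting
  the ball at \<open>c s\<close> is maximal along the curve there, so its kernel contains the tangent vector;
  this is where smoothness of the circle enters.\<close>

lemma ex1_birkhoff_map:
  assumes "v \<noteq> 0"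
  shows "\<exists>!w. w \<in> sphere 0 1 \<and> birkhoff_orth v w \<and> \<omega> v w > 0"
proof -
  obtain c c' :: "real \<Rightarrow> 'a" where c: "\<And>s. (c has_vector_derivative c' s) (at s)"
    "\<And>s. \<omega> (c s) (c' s) > 0" "range c = sphere 0 1"
    using unit_circle_parametrization by metis
  have unit: "norm (c s) = 1" for s using c(3) by auto
  have "inverse (norm v) *\<^sub>R v \<in> sphere 0 1" using assms by simp
  then obtain s where "inverse (norm v) *\<^sub>R v = c s" using c(3) by (metis imageE)
  then have v: "v = norm v *\<^sub>R c s" using assms by (metis divideR_right norm_eq_zero)
  have c'0: "c' s \<noteq> 0" using c(2)[of s] by (auto simp: omega.zero_right)
  let ?w = "inverse (norm (c' s)) *\<^sub>R c' s"
  have "birkhoff_orth v ?w"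
    using birkhoff_orth_scaleR[OF birkhoff_orth_tangent[OF c(1) unit]] v by metis
  moreover have "\<omega> v ?w > 0"
    using assms c'0 c(2)[of s] by (subst v) (simp add: omega.scaleR_left omega.scaleR_right)
  moreover have "w = ?w" if w: "norm w = 1" "birkhoff_orth v w" "\<omega> v w > 0" for w
  proof -
    have orth: "birkhoff_orth (c s) w"
      using birkhoff_orth_scaleR[OF w(2), of "inverse (norm v)" 1] v assms
      by (metis divideR_right norm_eq_zero scaleR_one)
    have pos: "\<omega> (c s) w > 0"
      using w(3) assms by (subst (asm) v) (simp add: omega.scaleR_left zero_less_mult_iff)
    have "\<omega> (c u) w \<le> \<omega> (c s) w" for u
      using birkhoff_orth_support[OF orth, of "c u"] unit pos by simp
    moreover have "((\<lambda>u. \<omega> (c u) w) has_real_derivative \<omega> (c' s) w) (at s)"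
      using bounded_linear.has_vector_derivative[OF omega.bounded_linear_left c(1)]
      by (simp add: has_real_derivative_iff_has_vector_derivative)
    ultimately have "\<omega> (c' s) w = 0"
      using DERIV_local_max[of "\<lambda>u. \<omega> (c u) w" "\<omega> (c' s) w" s 1] by simp
    then obtain r where r: "w = r *\<^sub>R c' s" using parallel c'0 by blast
    then have "r > 0" using pos c(2)[of s] by (simp add: omega.scaleR_right zero_less_mult_iff)
    then have "r = inverse (norm (c' s))" using w(1) r c'0 by (simp add: field_simps)
    then show ?thesis using r by simp
  qed
  ultimately show ?thesis using c'0 by (intro ex1I[of _ ?w]) auto
qed

lemma birkhoff_map:
  assumes "v \<noteq> 0"
  shows "norm (birkhoff_map \<omega> v) = 1" "birkhoff_orth v (birkhoff_map \<omega> v)"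
    "\<omega> v (birkhoff_map \<omega> v) > 0"
  using theI'[OF ex1_birkhoff_map[OF assms]] by (auto simp: birkhoff_map_def)

lemma birkhoff_map_eqI:
  assumes "v \<noteq> 0" "norm w = 1" "birkhoff_orth v w" "\<omega> v w > 0"
  shows "birkhoff_map \<omega> v = w"
  using the1_equality[OF ex1_birkhoff_map[OF assms(1)]] assms by (simp add: birkhoff_map_def)

lemma birkhoff_map_uminus:
  assumes "v \<noteq> 0"
  shows "birkhoff_map \<omega> (- v) = - birkhoff_map \<omega> v"
  using birkhoff_map[OF assms] birkhoff_orth_scaleR[of v "birkhoff_map \<omega> v" "-1" "-1"] assms
  by (intro birkhoff_map_eqI) (auto simp: omega.minus_left omega.minus_right)

lemma birkhoff_map_tangent:
  assumes "(c has_vector_derivative c') (at s)" "\<And>u. norm (c u) = 1" "\<omega> (c s) c' > 0"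
  shows "birkhoff_map \<omega> (c s) = inverse (norm c') *\<^sub>R c'"
proof -
  have "c' \<noteq> 0" using assms(3) by (auto simp: omega.zero_right)
  moreover have "c s \<noteq> 0" using assms(2)[of s] by auto
  ultimately show ?thesis
    using assms birkhoff_orth_scaleR[OF birkhoff_orth_tangent[OF assms(1,2)], of 1 "inverse (norm c')"]
    by (intro birkhoff_map_eqI) (simp_all add: omega.scaleR_right)
qed

text \<open>At a point where \<open>\<omega> _ w\<close> is maximal on the circle, \<open>w\<close> is tangent to the circle.\<close>

lemma surj_birkhoff_map: "sphere 0 1 \<subseteq> birkhoff_map \<omega> ` sphere 0 1"
proof
  fix w :: 'a assume "w \<in> sphere 0 1"
  then have w: "norm w = 1" "w \<noteq> 0" by auto
  obtain c c' :: "real \<Rightarrow> 'a" where c: "\<And>s. (c has_vector_derivative c' s) (at s)"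
    "\<And>s. \<omega> (c s) (c' s) > 0" "range c = sphere 0 1"
    using unit_circle_parametrization by metis
  have unit: "norm (c s) = 1" for s using c(3) by auto
  have "continuous_on (sphere 0 1) (\<lambda>x. \<omega> x w)"
    by (intro omega.continuous_on continuous_on_id continuous_on_const)
  moreover have "sphere (0::'a) 1 \<noteq> {}" using c(3) by blast
  ultimately obtain x where x: "x \<in> sphere 0 1" "\<forall>y\<in>sphere 0 1. \<omega> y w \<le> \<omega> x w"
    using continuous_attains_sup[OF compact_unit_sphere] by blast
  then obtain s where s: "x = c s" using c(3) by (metis imageE)
  have "((\<lambda>u. \<omega> (c u) w) has_real_derivative \<omega> (c' s) w) (at s)"
    using bounded_linear.has_vector_derivative[OF omega.bounded_linear_left c(1)]
    by (simp add: has_real_derivative_iff_has_vector_derivative)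
  moreover have "\<omega> (c u) w \<le> \<omega> (c s) w" for u using x(2) unit[of u] by (simp add: s)
  ultimately have "\<omega> (c' s) w = 0"
    using DERIV_local_max[of "\<lambda>u. \<omega> (c u) w" "\<omega> (c' s) w" s 1] by simp
  moreover have "c' s \<noteq> 0" using c(2)[of s] by (auto simp: omega.zero_right)
  ultimately obtain r where "w = r *\<^sub>R c' s" using parallel by blast
  then have orth: "birkhoff_orth x w"
    using birkhoff_orth_scaleR[OF birkhoff_orth_tangent[OF c(1)[of s] unit], of 1 r] by (simp add: s)
  have "\<omega> (- x) w \<le> \<omega> x w" using x by auto
  then have "\<omega> x w \<ge> 0" by (simp add: omega.minus_left)
  moreover have "\<omega> x w \<noteq> 0" using birkhoff_orth_independent[OF orth] x(1) w(2) by (cases "x = 0") auto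
  ultimately have "birkhoff_map \<omega> x = w" using x(1) w orth by (intro birkhoff_map_eqI) auto
  then show "w \<in> birkhoff_map \<omega> ` sphere 0 1" using x(1) by blast
qed

lemma birkhoff_map_support:
  assumes "norm v = 1" "norm y \<le> 1"
  shows "\<omega> y (birkhoff_map \<omega> v) \<le> \<omega> v (birkhoff_map \<omega> v)"
proof -
  have v: "v \<noteq> 0" using assms(1) by auto
  have "\<bar>\<omega> y (birkhoff_map \<omega> v)\<bar> \<le> \<omega> v (birkhoff_map \<omega> v) * norm y"
    using birkhoff_orth_support[OF birkhoff_map(2)[OF v], of y] birkhoff_map(3)[OF v] assms(1) by simp
  also have "\<dots> \<le> \<omega> v (birkhoff_map \<omega> v) * 1"
    using birkhoff_map(3)[OF v] assms(2) by (intro mult_left_mono) auto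
  finally show ?thesis by simp
qed

text \<open>Points with the same image \<open>w\<close> both maximize \<open>\<omega> _ w\<close> on the ball, and so does the segment
  between them, which therefore consists of unit vectors.\<close>

lemma inj_on_birkhoff_map:
  assumes strict: "\<not> (\<exists>x y :: 'a. x \<noteq> y \<and> closed_segment x y \<subseteq> sphere 0 1)"
  shows "inj_on (birkhoff_map \<omega>) (sphere 0 1)"
proof (rule inj_onI, rule ccontr)
  fix x y :: 'a assume xy: "x \<in> sphere 0 1" "y \<in> sphere 0 1" "birkhoff_map \<omega> x = birkhoff_map \<omega> y" "x \<noteq> y"
  let ?w = "birkhoff_map \<omega> x"
  have n: "norm x = 1" "norm y = 1" and x0: "x \<noteq> 0" using xy by auto
  have eq: "\<omega> y ?w = \<omega> x ?w"
    using birkhoff_map_support[of x y] birkhoff_map_support[of y x] n xy(3) by simp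
  have "norm z = 1" if z: "z \<in> closed_segment x y" for z
  proof -
    obtain u where u: "0 \<le> u" "u \<le> 1" "z = (1 - u) *\<^sub>R x + u *\<^sub>R y" using z by (auto simp: closed_segment_def)
    have "norm z \<le> norm ((1 - u) *\<^sub>R x) + norm (u *\<^sub>R y)" using u(3) norm_triangle_ineq by blast
    then have le: "norm z \<le> 1" using u n by simp
    have "\<omega> z ?w = \<omega> x ?w"
      unfolding u(3) by (simp add: eq omega.add_left omega.scaleR_left) (simp add: algebra_simps)
    then have "norm z \<ge> 1"
      using birkhoff_orth_support[OF birkhoff_map(2)[OF x0], of z] birkhoff_map(3)[OF x0] n by simp
    with le show ?thesis by simp
  qed
  then have "closed_segment x y \<subseteq> sphere 0 1" by auto
  then show False using strict xy(4) by blast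
qed

text \<open>Each point of the circle maximizes the functional given by its own tangent direction; this is
  the sum of the two resulting inequalities.\<close>

lemma birkhoff_map_monotone:
  assumes "norm u = 1" "norm v = 1"
  shows "\<omega> (v - u) (birkhoff_map \<omega> v - birkhoff_map \<omega> u) \<ge> 0"
  using birkhoff_map_support[of u v] birkhoff_map_support[of v u] assms
  by (simp add: omega.diff_left omega.diff_right)

section \<open>Rays as a smooth parameter\<close>

text \<open>With \<open>p = g s0\<close> and \<open>q = g' s0\<close>, the quotient \<open>h x = \<omega> p x / \<omega> x q\<close> is constant on rays, and
  \<open>h \<circ> g\<close> has derivative \<open>1\<close> at \<open>s0\<close>. A local inverse \<open>k\<close> of \<open>h \<circ> g\<close> gives the parameter
  \<open>\<theta> = k \<circ> h\<close>. Smoothness of \<open>\<theta>\<close> is recorded as smoothness along every smooth curve, which is how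
  it gets used and spares higher derivatives of functions on the plane.\<close>

lemma smooth_ray_parameter:
  fixes g g' :: "real \<Rightarrow> 'a"
  assumes gn: "\<And>n. times_differentiable_on n UNIV g"
    and g'n: "\<And>n. times_differentiable_on n UNIV g'"
    and der: "\<And>s. (g has_vector_derivative g' s) (at s)"
    and indep: "\<omega> (g s0) (g' s0) \<noteq> 0"
  obtains V \<theta> where "open V" "g s0 \<in> V" "\<theta> (g s0) = s0"
    "\<And>v. v \<in> V \<Longrightarrow> \<exists>r>0. v = r *\<^sub>R g (\<theta> v)"
    "\<And>v. v \<in> V \<Longrightarrow> \<theta> differentiable (at v)"
    "\<And>n I x. times_differentiable_on n I x \<Longrightarrow> x ` I \<subseteq> V \<Longrightarrow> times_differentiable_on n I (\<lambda>t. \<theta> (x t))"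
proof -
  let ?p = "g s0" and ?q = "g' s0"
  define D where "D = \<omega> ?p ?q"
  have D: "D \<noteq> 0" using indep by (simp add: D_def)
  then have DD: "0 < D * D" using not_real_square_gt_zero by blast
  define h where "h x = \<omega> ?p x / \<omega> x ?q" for x
  \<comment> \<open>the numerator of the derivative of \<open>h \<circ> g\<close>\<close>
  define num where "num s = \<omega> ?p (g' s) * \<omega> (g s) ?q - \<omega> ?p (g s) * \<omega> (g' s) ?q" for s
  define U where "U = {s. 0 < \<omega> (g s) ?q * D} \<inter> {s. num s \<noteq> 0}"
  have cg: "continuous_on UNIV g" using der
    by (auto simp: continuous_on_eq_continuous_within intro: has_vector_derivative_continuous)
  have cg': "continuous_on UNIV g'" using g'n[of "Suc 0"]
    by (auto simp: continuous_on_eq_continuous_within intro: has_vector_derivative_continuous)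
  have openU: "open U" unfolding U_def num_def
    by (intro open_Int open_Collect_less open_Collect_neq continuous_intros omega.continuous_on cg cg')
  have s0U: "s0 \<in> U" using D DD by (simp add: U_def num_def alternating flip: D_def)
  have derU: "((\<lambda>s. h (g s)) has_real_derivative num s / (\<omega> (g s) ?q)\<^sup>2) (at s)" if "s \<in> U" for s
  proof -
    have "((\<lambda>s. \<omega> ?p (g s)) has_real_derivative \<omega> ?p (g' s)) (at s)"
      using bounded_linear.has_vector_derivative[OF omega.bounded_linear_right der]
      by (simp add: has_real_derivative_iff_has_vector_derivative)
    moreover have "((\<lambda>s. \<omega> (g s) ?q) has_real_derivative \<omega> (g' s) ?q) (at s)"
      using bounded_linear.has_vector_derivative[OF omega.bounded_linear_left der]
      by (simp add: has_real_derivative_iff_has_vector_derivative)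
    moreover have "\<omega> (g s) ?q \<noteq> 0" using that by (auto simp: U_def)
    ultimately show ?thesis unfolding h_def num_def
      by (auto intro!: derivative_eq_intros simp: power2_eq_square)
  qed
  have smoothU: "times_differentiable_on n U (\<lambda>s. num s / (\<omega> (g s) ?q)\<^sup>2)" for n
    unfolding num_def power2_eq_square
    by (intro times_differentiable_on_divide times_differentiable_on_diff times_differentiable_on_mult
        times_differentiable_on_bilinear[OF omega.bounded_bilinear_axioms] times_differentiable_on_const
        times_differentiable_on_subset[OF gn] times_differentiable_on_subset[OF g'n])
       (auto simp: U_def)
  have nzU: "num s / (\<omega> (g s) ?q)\<^sup>2 \<noteq> 0" if "s \<in> U" for s using that by (auto simp: U_def)
  obtain W k where W: "open W" "h ?p \<in> W" "k (h ?p) = s0" "k ` W \<subseteq> U"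
    "\<And>y. y \<in> W \<Longrightarrow> h (g (k y)) = y" "\<And>y. y \<in> W \<Longrightarrow> k differentiable (at y)"
    "\<And>n. times_differentiable_on n W k"
    using local_smooth_inverse[OF openU s0U derU smoothU nzU] by metis
  \<comment> \<open>\<open>h\<close> only sees lines; restricting to this half-plane, which contains \<open>g s0\<close>, distinguishes \<open>x\<close> from \<open>- x\<close>\<close>
  define C where "C = {x. 0 < \<omega> x ?q * D}"
  have C: "open C" unfolding C_def
    by (intro open_Collect_less continuous_intros omega.continuous_on)
  have ch: "continuous_on C h" unfolding h_def
    by (intro continuous_intros omega.continuous_on) (auto simp: C_def)
  define V where "V = C \<inter> h -` W"
  show thesis
  proof (rule that[of V "\<lambda>v. k (h v)"])
    show "open V" unfolding V_def by (rule continuous_open_preimage[OF ch C W(1)])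
    show "?p \<in> V" using W(2) DD by (simp add: V_def C_def flip: D_def)
    show "k (h ?p) = s0" by (rule W(3))
    show "\<exists>r>0. v = r *\<^sub>R g (k (h v))" if v: "v \<in> V" for v
    proof -
      let ?y = "g (k (h v))"
      have hv: "h v \<in> W" "0 < \<omega> v ?q * D" using v by (auto simp: V_def C_def)
      have y: "h ?y = h v" "0 < \<omega> ?y ?q * D" using W(4,5) hv(1) by (auto simp: U_def)
      let ?r = "\<omega> v ?q / \<omega> ?y ?q"
      have nz: "\<omega> v ?q \<noteq> 0" "\<omega> ?y ?q \<noteq> 0" using y hv by auto
      have "?r = (\<omega> v ?q * D) / (\<omega> ?y ?q * D)" using D by simp
      then have "?r > 0" using y(2) hv(2) by (metis divide_pos_pos)
      moreover have "v = ?r *\<^sub>R ?y"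
      proof -
        have "\<omega> ?p v = ?r * \<omega> ?p ?y" "\<omega> v ?q = ?r * \<omega> ?y ?q"
          using y(1) nz by (simp_all add: h_def field_simps)
        then have "(\<omega> v ?q / \<omega> ?p ?q) *\<^sub>R ?p + (\<omega> ?p v / \<omega> ?p ?q) *\<^sub>R ?q
            = ?r *\<^sub>R ((\<omega> ?y ?q / \<omega> ?p ?q) *\<^sub>R ?p + (\<omega> ?p ?y / \<omega> ?p ?q) *\<^sub>R ?q)"
          by (simp only: scaleR_add_right scaleR_scaleR times_divide_eq_right)
        then show ?thesis using decomposition[OF indep] by metis
      qed
      ultimately show ?thesis by blast
    qed
    show "(\<lambda>v. k (h v)) differentiable (at v)" if v: "v \<in> V" for v
    proof -
      have "\<omega> v ?q \<noteq> 0" "h v \<in> W" using v by (auto simp: V_def C_def)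
      then have "h differentiable (at v)" unfolding h_def
        by (intro differentiable_divide bounded_linear_imp_differentiable omega.bounded_linear_left omega.bounded_linear_right)
      from differentiable_chain_at[OF this W(6)[OF \<open>h v \<in> W\<close>]] show ?thesis by (simp add: o_def)
    qed
    show "times_differentiable_on n I (\<lambda>t. k (h (x t)))"
      if x: "times_differentiable_on n I x" "x ` I \<subseteq> V" for n I x
    proof (rule times_differentiable_on_compose[OF W(7)])
      show "(\<lambda>t. h (x t)) ` I \<subseteq> W" using x(2) by (auto simp: V_def)
      have "\<omega> (x t) ?q \<noteq> 0" if "t \<in> I" for t using x(2) that by (force simp: V_def C_def)
      then show "times_differentiable_on n I (\<lambda>t. h (x t))" unfolding h_def
        by (intro times_differentiable_on_divide x(1) times_differentiable_on_const
            times_differentiable_on_bilinear[OF omega.bounded_bilinear_axioms])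
    qed
  qed
qed

text \<open>Near \<open>c s0\<close> one has \<open>x = norm x *\<^sub>R c (\<theta> x)\<close> with a differentiable ray parameter \<open>\<theta>\<close>; applying
  a linear functional to both sides expresses the norm as a quotient of differentiable functions.\<close>

lemma norm_differentiable:
  assumes "v \<noteq> (0::'a)"
  shows "norm differentiable (at v)"
proof -
  obtain c c' :: "real \<Rightarrow> 'a" where c:
    "\<And>n. times_differentiable_on n UNIV c" "\<And>n. times_differentiable_on n UNIV c'"
    "\<And>s. (c has_vector_derivative c' s) (at s)" "\<And>s. \<omega> (c s) (c' s) > 0" "range c = sphere 0 1"
    using unit_circle_parametrization by blast
  have unit: "norm (c s) = 1" for s using c(5) by auto
  let ?u = "inverse (norm v) *\<^sub>R v"
  have "?u \<in> sphere 0 1" using assms by simp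
  then obtain s0 where s0: "?u = c s0" using c(5) by (metis imageE)
  have "\<omega> (c s0) (c' s0) \<noteq> 0" using c(4)[of s0] by simp
  from smooth_ray_parameter[OF c(1,2,3) this] obtain V \<theta> where V: "open V" "c s0 \<in> V" "\<theta> (c s0) = s0"
    "\<And>v. v \<in> V \<Longrightarrow> \<exists>r>0. v = r *\<^sub>R c (\<theta> v)" "\<And>v. v \<in> V \<Longrightarrow> \<theta> differentiable (at v)"
    by metis
  let ?q = "c' s0"
  let ?N = "\<lambda>x. \<omega> x ?q / \<omega> (c (\<theta> x)) ?q"
  have "c differentiable (at s0)" using c(3) by (rule differentiableI_vector)
  then have "(c \<circ> \<theta>) differentiable (at (c s0))"
    using V(2,3,5) by (intro differentiable_chain_at) auto
  then have "((\<lambda>x. \<omega> x ?q) \<circ> (c \<circ> \<theta>)) differentiable (at (c s0))"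
    by (rule differentiable_chain_at[OF _ bounded_linear_imp_differentiable[OF omega.bounded_linear_left]])
  then have "?N differentiable (at (c s0))"
    using \<open>\<omega> (c s0) (c' s0) \<noteq> 0\<close> V(3)
    by (intro differentiable_divide bounded_linear_imp_differentiable[OF omega.bounded_linear_left])
       (auto simp: o_def)
  then obtain N' where N': "(?N has_derivative N') (at (c s0))" unfolding differentiable_def by blast
  have "open (V \<inter> {x. \<omega> x ?q \<noteq> 0})"
    by (intro open_Int V(1) open_Collect_neq omega.continuous_on continuous_intros)
  moreover have "?N x = norm x" if x: "x \<in> V \<inter> {x. \<omega> x ?q \<noteq> 0}" for x
  proof -
    obtain r where r: "r > 0" "x = r *\<^sub>R c (\<theta> x)" using V(4) x by blast
    have "norm x = r" using r unit by (metis abs_of_pos mult.right_neutral norm_scaleR)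
    moreover have "\<omega> x ?q = r * \<omega> (c (\<theta> x)) ?q" by (subst r(2)) (simp add: omega.scaleR_left)
    ultimately show ?thesis using x by auto
  qed
  ultimately have "(norm has_derivative N') (at (c s0))"
    using has_derivative_transform_within_open[OF N'] V(2) \<open>\<omega> (c s0) (c' s0) \<noteq> 0\<close> by blast
  then have "norm differentiable (at ?u)" unfolding s0 differentiable_def by blast
  then have "(norm \<circ> (\<lambda>x. inverse (norm v) *\<^sub>R x)) differentiable (at v)"
    by (intro differentiable_chain_at[OF bounded_linear_imp_differentiable[OF bounded_linear_scaleR_right]])
  then have "(\<lambda>x. norm v * (norm \<circ> (\<lambda>x. inverse (norm v) *\<^sub>R x)) x) differentiable (at v)"
    by (intro differentiable_mult differentiable_const)
  moreover have "(\<lambda>x::'a. norm v * (norm \<circ> (\<lambda>x. inverse (norm v) *\<^sub>R x)) x) = norm"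
    using assms by auto
  ultimately show ?thesis by (simp only:)
qed

text \<open>The supporting functional at \<open>v\<close> lies below the norm and touches it at \<open>v\<close>, so once the norm is
  differentiable this functional is its derivative.\<close>

lemma norm_has_derivative:
  assumes "norm v = 1"
  shows "(norm has_derivative (\<lambda>y. \<omega> y (birkhoff_map \<omega> v) / \<omega> v (birkhoff_map \<omega> v))) (at v)"
proof -
  have v: "v \<noteq> 0" using assms by auto
  let ?b = "birkhoff_map \<omega> v"
  obtain N' where N': "(norm has_derivative N') (at v)"
    using norm_differentiable[OF v] unfolding differentiable_def by blast
  have "((\<lambda>x. norm x - \<omega> x ?b / \<omega> v ?b) has_derivative (\<lambda>y. N' y - \<omega> y ?b / \<omega> v ?b)) (at v)"
    using bounded_linear.has_derivative[OF omega.bounded_linear_left has_derivative_ident] N'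
      birkhoff_map(3)[OF v]
    by (auto intro!: derivative_eq_intros)
  moreover have "norm v - \<omega> v ?b / \<omega> v ?b \<le> norm x - \<omega> x ?b / \<omega> v ?b" for x
  proof -
    have "\<bar>\<omega> x ?b\<bar> \<le> \<omega> v ?b * norm x"
      using birkhoff_orth_support[OF birkhoff_map(2)[OF v], of x] birkhoff_map(3)[OF v] assms by simp
    then have "\<omega> x ?b / \<omega> v ?b \<le> norm x" using birkhoff_map(3)[OF v] by (simp add: field_simps)
    then show ?thesis using birkhoff_map(3)[OF v] assms by simp
  qed
  ultimately have "(\<lambda>y. N' y - \<omega> y ?b / \<omega> v ?b) = (\<lambda>y. 0)"
    by (intro has_derivative_local_min) (auto intro: always_eventually)
  then have "N' = (\<lambda>y. \<omega> y ?b / \<omega> v ?b)" by (auto simp: fun_eq_iff)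
  with N' show ?thesis by simp
qed

text \<open>Differentiating \<open>norm (x s) = 1\<close> rather than maximizing a functional along \<open>x\<close> covers the case
  in which \<open>t\<close> is an end point of \<open>I\<close>.\<close>

lemma unit_curve_tangent:
  assumes "(x has_vector_derivative x') (at t within I)" "t \<in> I" "t islimpt I"
    and unit: "\<And>s. s \<in> I \<Longrightarrow> norm (x s) = 1"
  shows "\<omega> x' (birkhoff_map \<omega> (x t)) = 0"
proof -
  let ?b = "birkhoff_map \<omega> (x t)"
  have x0: "x t \<noteq> 0" using unit[OF assms(2)] by auto
  have "((norm \<circ> x) has_vector_derivative \<omega> x' ?b / \<omega> (x t) ?b) (at t within I)"
    using vector_derivative_diff_chain_within[OF assms(1)
        has_derivative_at_withinI[OF norm_has_derivative[OF unit[OF assms(2)]]]] .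
  moreover have "((norm \<circ> x) has_vector_derivative 0) (at t within I)"
    by (rule has_vector_derivative_transform[OF assms(2) _ has_vector_derivative_const[of 1]])
       (simp add: unit)
  ultimately have "\<omega> x' ?b / \<omega> (x t) ?b = 0"
    using vector_derivative_unique_within assms(3) trivial_limit_within by metis
  then show ?thesis using birkhoff_map(3)[OF x0] by simp
qed

text \<open>Being constant on rays, the Birkhoff map is near \<open>v\<close> the unit tangent of \<open>c\<close> at the ray
  parameter.\<close>

lemma birkhoff_map_differentiable:
  assumes "norm v = 1"
  shows "birkhoff_map \<omega> differentiable (at v)"
proof -
  obtain c c' :: "real \<Rightarrow> 'a" where c:
    "\<And>n. times_differentiable_on n UNIV c" "\<And>n. times_differentiable_on n UNIV c'"
    "\<And>s. (c has_vector_derivative c' s) (at s)" "\<And>s. \<omega> (c s) (c' s) > 0" "range c = sphere 0 1"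
    using unit_circle_parametrization by blast
  have unit: "norm (c s) = 1" for s using c(5) by auto
  have "v \<in> sphere 0 1" using assms by simp
  then obtain s0 where s0: "v = c s0" using c(5) by (metis imageE)
  have c'0: "c' s \<noteq> 0" for s using c(4)[of s] by (auto simp: omega.zero_right)
  have "\<omega> (c s0) (c' s0) \<noteq> 0" using c(4)[of s0] by simp
  from smooth_ray_parameter[OF c(1,2,3) this] obtain V \<theta> where V: "open V" "c s0 \<in> V" "\<theta> (c s0) = s0"
    "\<And>v. v \<in> V \<Longrightarrow> \<exists>r>0. v = r *\<^sub>R c (\<theta> v)" "\<And>v. v \<in> V \<Longrightarrow> \<theta> differentiable (at v)"
    by metis
  let ?B = "\<lambda>x. inverse (norm (c' (\<theta> x))) *\<^sub>R c' (\<theta> x)"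
  have "c' differentiable (at s0)"
    using c(2)[of "Suc 0"] by (auto intro: differentiableI_vector)
  then have *: "(c' \<circ> \<theta>) differentiable (at v)"
    using V(2,3,5) s0 by (intro differentiable_chain_at) auto
  moreover have "(norm \<circ> (c' \<circ> \<theta>)) differentiable (at v)"
    using c'0 by (intro differentiable_chain_at * norm_differentiable) auto
  ultimately have "?B differentiable (at v)"
    using c'0 by (intro differentiable_scaleR differentiable_inverse) (auto simp: o_def)
  then obtain B' where B': "(?B has_derivative B') (at v)" unfolding differentiable_def by blast
  have "?B x = birkhoff_map \<omega> x" if x: "x \<in> V" for x
  proof -
    obtain r where r: "r > 0" "x = r *\<^sub>R c (\<theta> x)" using V(4) x by blast
    have "birkhoff_map \<omega> x = birkhoff_map \<omega> (c (\<theta> x))"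
      using birkhoff_map_scaleR[OF bilinear r(1)] r(2) by metis
    then show ?thesis using birkhoff_map_tangent[OF c(3) unit c(4)] by simp
  qed
  with has_derivative_transform_within_open[OF B' V(1)] V(2) s0 show ?thesis
    unfolding differentiable_def by blast
qed

section \<open>The normal of the evolute\<close>

text \<open>The unit tangent \<open>N = b \<circ> c\<close> has derivative \<open>norm c' *\<^sub>R Db (b c)\<close>, of length
  \<open>norm c' * rho \<noteq> 0\<close>. Since \<open>N\<close> runs on the unit circle, \<open>N'\<close> is tangent to the circle at \<open>N\<close>
  and hence independent of \<open>N\<close>; passing from \<open>N\<close> to \<open>c' = norm c' *\<^sub>R N\<close> changes \<open>\<omega> N N'\<close> only by
  the positive factor \<open>(norm c')\<^sup>2\<close>.\<close>

lemma tangent_turns: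
  fixes c c' :: "real \<Rightarrow> 'a"
  assumes der: "\<And>s. (c has_vector_derivative c' s) (at s)"
    and der2: "(c' has_vector_derivative c'') (at s0)"
    and unit: "\<And>s. norm (c s) = 1" and pos: "\<And>s. \<omega> (c s) (c' s) > 0"
    and rho: "rho \<omega> (c s0) \<noteq> 0"
  shows "\<omega> (c' s0) c'' \<noteq> 0"
proof -
  let ?b = "birkhoff_map \<omega>"
  have c'0: "c' s \<noteq> 0" for s using pos[of s] by (auto simp: omega.zero_right)
  define D where "D = frechet_derivative ?b (at (c s0))"
  have D: "(?b has_derivative D) (at (c s0))"
    using birkhoff_map_differentiable[OF unit] frechet_derivative_works by (auto simp: D_def)
  have c0: "c s \<noteq> 0" for s using unit by (metis norm_zero zero_neq_one)
  let ?N = "\<lambda>s. ?b (c s)" and ?N' = "D (c' s0)"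
  have c'N: "c' s = norm (c' s) *\<^sub>R ?N s" for s
    using birkhoff_map_tangent[OF der unit pos] c'0 by simp
  have N': "(?N has_vector_derivative ?N') (at s0)"
    using vector_derivative_diff_chain_within[OF der has_derivative_at_withinI[OF D]] by (simp add: o_def)
  have "?N' = norm (c' s0) *\<^sub>R D (?b (c s0))"
    using linear.scaleR[OF has_derivative_linear[OF D], of "norm (c' s0)" "?N s0"] c'N[of s0] by simp
  then have N'0: "?N' \<noteq> 0" using rho c'0 by (auto simp: rho_def D_def)
  have "\<omega> ?N' (?b (?N s0)) = 0"
  proof (rule unit_curve_tangent[OF N'])
    show "norm (?N s) = 1" for s by (rule birkhoff_map(1)[OF c0])
  qed (auto simp: islimpt_UNIV)
  then have "\<omega> (?b (?N s0)) ?N' = 0" using skew[of "?b (?N s0)" ?N'] by simp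
  moreover have N0: "?N s0 \<noteq> 0"
    using birkhoff_map(1)[OF c0] by (metis norm_zero zero_neq_one)
  then have "?b (?N s0) \<noteq> 0" using birkhoff_map(1) by (metis norm_zero zero_neq_one)
  ultimately obtain r where r: "?N' = r *\<^sub>R ?b (?N s0)" using parallel by blast
  then have "r \<noteq> 0" using N'0 by auto
  then have wN: "\<omega> (?N s0) ?N' \<noteq> 0" using r birkhoff_map(3)[OF N0] by (simp add: omega.scaleR_right)
  have "((norm \<circ> c') has_derivative frechet_derivative norm (at (c' s0)) \<circ> (\<lambda>h. h *\<^sub>R c'')) (at s0)"
    using norm_differentiable[OF c'0[of s0]] frechet_derivative_works der2
    by (intro diff_chain_at) (auto simp: has_vector_derivative_def)
  then have "(norm \<circ> c') differentiable (at s0)" unfolding differentiable_def by blast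
  then obtain m' where m': "((\<lambda>s. norm (c' s)) has_real_derivative m') (at s0)"
    by (auto simp: real_differentiable_def o_def)
  have "((\<lambda>s. norm (c' s) *\<^sub>R ?N s) has_vector_derivative norm (c' s0) *\<^sub>R ?N' + m' *\<^sub>R ?N s0) (at s0)"
    by (rule has_vector_derivative_scaleR[OF m' N'])
  then have "(c' has_vector_derivative norm (c' s0) *\<^sub>R ?N' + m' *\<^sub>R ?N s0) (at s0)"
    by (simp flip: c'N)
  then have "c'' = norm (c' s0) *\<^sub>R ?N' + m' *\<^sub>R ?N s0"
    using der2 vector_derivative_unique_at by blast
  then have "\<omega> (c' s0) c'' = norm (c' s0) * norm (c' s0) * \<omega> (?N s0) ?N'"
    by (subst (1) c'N[of s0]) (simp add: omega.scaleR_left omega.scaleR_right omega.add_right alternating)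
  then show ?thesis using wN c'0 by simp
qed

text \<open>Surjectivity makes the inverse image a genuine one, injectivity makes it unique, and oddness of
  the Birkhoff map moves the sign inside.\<close>

lemma evolute_normal:
  assumes strict: "\<not> (\<exists>x y :: 'a. x \<noteq> y \<and> closed_segment x y \<subseteq> sphere 0 1)"
    and unit: "norm (\<eta> t) = 1"
  shows "norm (evolute_normal \<omega> \<eta> t) = 1"
    and "birkhoff_map \<omega> (evolute_normal \<omega> \<eta> t) = - \<eta> t"
    and "norm u = 1 \<Longrightarrow> birkhoff_map \<omega> u = - \<eta> t \<Longrightarrow> evolute_normal \<omega> \<eta> t = u"
proof -
  let ?x = "inv_into (sphere 0 1) (birkhoff_map \<omega>) (\<eta> t)"
  have mem: "\<eta> t \<in> birkhoff_map \<omega> ` sphere 0 1" using surj_birkhoff_map unit by auto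
  have x: "norm ?x = 1" "birkhoff_map \<omega> ?x = \<eta> t"
    using inv_into_into[OF mem] f_inv_into_f[OF mem] by auto
  then have "?x \<noteq> 0" by auto
  from x birkhoff_map_uminus[OF this]
  show 1: "norm (evolute_normal \<omega> \<eta> t) = 1" "birkhoff_map \<omega> (evolute_normal \<omega> \<eta> t) = - \<eta> t"
    by (simp_all add: evolute_normal_def)
  show "evolute_normal \<omega> \<eta> t = u" if "norm u = 1" "birkhoff_map \<omega> u = - \<eta> t"
    using inj_onD[OF inj_on_birkhoff_map[OF strict], of "evolute_normal \<omega> \<eta> t" u] 1 that by simp
qed

text \<open>Near \<open>t0\<close>, \<open>\<nu> t\<close> is the point of the circle whose tangent vector lies on the ray of
  \<open>- \<eta> t\<close>, and this point depends smoothly on the ray.\<close>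

lemma smooth_evolute_normal:
  assumes strict: "\<not> (\<exists>x y :: 'a. x \<noteq> y \<and> closed_segment x y \<subseteq> sphere 0 1)"
    and perf: "\<And>t. t \<in> I \<Longrightarrow> t islimpt I"
    and \<eta>: "\<And>n. times_differentiable_on n I \<eta>" and unit: "\<And>t. t \<in> I \<Longrightarrow> norm (\<eta> t) = 1"
    and rho: "\<And>t. t \<in> I \<Longrightarrow> rho \<omega> (evolute_normal \<omega> \<eta> t) \<noteq> 0"
  shows "times_differentiable_on n I (evolute_normal \<omega> \<eta>)"
proof (rule times_differentiable_on_locally[OF perf])
  fix t0 assume t0: "t0 \<in> I"
  let ?b = "birkhoff_map \<omega>" and ?\<nu> = "evolute_normal \<omega> \<eta>"
  obtain c c' :: "real \<Rightarrow> 'a" where c: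
    "\<And>n. times_differentiable_on n UNIV c" "\<And>n. times_differentiable_on n UNIV c'"
    "\<And>s. (c has_vector_derivative c' s) (at s)" "\<And>s. \<omega> (c s) (c' s) > 0" "range c = sphere 0 1"
    using unit_circle_parametrization by blast
  have cunit: "norm (c s) = 1" for s using c(5) by auto
  have c'0: "c' s \<noteq> 0" for s using c(4)[of s] by (auto simp: omega.zero_right)
  have bc: "c' s = norm (c' s) *\<^sub>R ?b (c s)" for s
    using birkhoff_map_tangent[OF c(3) cunit c(4)] c'0 by simp
  have "?\<nu> t0 \<in> sphere 0 1" using evolute_normal(1)[where \<eta>=\<eta>, OF strict unit[OF t0]] by simp
  then obtain s0 where s0: "?\<nu> t0 = c s0" using c(5) by (metis imageE)
  define c'' where "c'' s = vector_derivative c' (at s)" for s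
  have c''n: "times_differentiable_on n UNIV c''" for n
    using vector_derivative_times_differentiable_on(2)[OF c(2)] by (simp add: islimpt_UNIV c''_def[abs_def])
  have der2: "(c' has_vector_derivative c'' s) (at s)" for s
    using vector_derivative_times_differentiable_on(1)[OF c(2), of s] by (simp add: islimpt_UNIV c''_def)
  have "\<omega> (c' s0) (c'' s0) \<noteq> 0"
    using tangent_turns[OF c(3) der2 cunit c(4)] rho[OF t0] by (simp add: s0)
  from smooth_ray_parameter[OF c(2) c''n der2 this]
  obtain V \<theta> where V: "open V" "c' s0 \<in> V"
    "\<And>v. v \<in> V \<Longrightarrow> \<exists>r>0. v = r *\<^sub>R c' (\<theta> v)"
    "\<And>x I n. times_differentiable_on n I x \<Longrightarrow> x ` I \<subseteq> V \<Longrightarrow> times_differentiable_on n I (\<lambda>t. \<theta> (x t))"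
    by metis
  \<comment> \<open>scaled so that \<open>x t0\<close> is the vector \<open>c' s0\<close> itself and not merely on its ray\<close>
  define x where "x t = (- norm (c' s0)) *\<^sub>R \<eta> t" for t
  have xn: "times_differentiable_on n I x" for n
    unfolding x_def by (intro times_differentiable_on_scaleR times_differentiable_on_const \<eta>)
  have "x t0 = c' s0"
    using bc[of s0] evolute_normal(2)[where \<eta>=\<eta>, OF strict unit[OF t0]] by (simp add: x_def s0)
  have "continuous_on I x" using xn[of "Suc 0"]
    by (auto simp: continuous_on_eq_continuous_within intro: has_vector_derivative_continuous)
  then obtain U where U: "open U" "U \<inter> I = x -` V \<inter> I"
    using V(1) unfolding continuous_on_open_invariant by blast
  have "times_differentiable_on n (I \<inter> U) (\<lambda>t. \<theta> (x t))"
    using U(2) by (intro V(4) times_differentiable_on_subset[OF xn]) auto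
  then have "times_differentiable_on n (I \<inter> U) (\<lambda>t. c (\<theta> (x t)))"
    by (intro times_differentiable_on_compose[OF c(1)]) auto
  moreover have "c (\<theta> (x t)) = ?\<nu> t" if t: "t \<in> I \<inter> U" for t
  proof -
    have "x t \<in> V" using U(2) t by auto
    then obtain r where r: "r > 0" "x t = r *\<^sub>R c' (\<theta> (x t))" using V(3) by blast
    let ?C = "c' (\<theta> (x t))"
    have "norm (x t) = r * norm ?C" using r by (metis abs_of_pos norm_scaleR)
    then have "norm (c' s0) = r * norm ?C" using unit t by (simp add: x_def)
    then have "r *\<^sub>R ?C = (r * norm ?C) *\<^sub>R (- \<eta> t)" using r(2) by (simp add: x_def)
    also have "r *\<^sub>R ?C = (r * norm ?C) *\<^sub>R ?b (c (\<theta> (x t)))" by (subst bc) simp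
    finally have "?b (c (\<theta> (x t))) = - \<eta> t" using r(1) c'0 by (simp only: scaleR_cancel_left) simp
    then show ?thesis using evolute_normal(3)[where \<eta>=\<eta>, OF strict] unit t cunit by (metis IntD1)
  qed
  ultimately have "times_differentiable_on n (I \<inter> U) ?\<nu>"
    by (rule times_differentiable_on_cong)
  moreover have "t0 \<in> U" using U(2) V(2) \<open>x t0 = c' s0\<close> t0 by auto
  ultimately show "\<exists>U. open U \<and> t0 \<in> U \<and> times_differentiable_on n (I \<inter> U) ?\<nu>"
    using U(1) by blast
qed

text \<open>Differentiating \<open>b \<nu> = - \<eta>\<close> determines \<open>\<bar>\<beta>\<bar>\<close>; its sign is the limit of the monotonicity of
  \<open>b\<close> applied to difference quotients.\<close>

lemma evolute_normal_derivative:
  assumes strict: "\<not> (\<exists>x y :: 'a. x \<noteq> y \<and> closed_segment x y \<subseteq> sphere 0 1)"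
    and t: "t \<in> I" "t islimpt I"
    and unit: "\<And>t. t \<in> I \<Longrightarrow> norm (\<eta> t) = 1"
    and \<nu>': "(evolute_normal \<omega> \<eta> has_vector_derivative \<nu>') (at t within I)"
    and \<eta>': "(\<eta> has_vector_derivative k *\<^sub>R birkhoff_map \<omega> (\<eta> t)) (at t within I)"
    and k: "k \<noteq> 0"
  shows "\<nu>' = - (k / rho \<omega> (evolute_normal \<omega> \<eta> t)) *\<^sub>R \<eta> t"
proof -
  let ?b = "birkhoff_map \<omega>" and ?\<nu> = "evolute_normal \<omega> \<eta>"
  note \<nu> = evolute_normal(1,2)[where \<eta>=\<eta>, OF strict unit]
  have \<nu>0: "?\<nu> t \<noteq> 0" and \<eta>0: "\<eta> t \<noteq> 0" using \<nu>(1)[OF t(1)] unit[OF t(1)] by auto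
  have "\<omega> \<nu>' (?b (?\<nu> t)) = 0"
    using unit_curve_tangent[OF \<nu>' t] \<nu>(1) by blast
  then have "\<omega> (\<eta> t) \<nu>' = 0" using \<nu>(2)[OF t(1)] skew[of "\<eta> t" \<nu>'] by (simp add: omega.minus_right)
  then obtain \<beta> where \<beta>: "\<nu>' = \<beta> *\<^sub>R \<eta> t" using parallel \<eta>0 by blast
  define D where "D = frechet_derivative ?b (at (?\<nu> t))"
  have D: "(?b has_derivative D) (at (?\<nu> t))"
    using birkhoff_map_differentiable[OF \<nu>(1)[OF t(1)]] frechet_derivative_works by (auto simp: D_def)
  have "((?b \<circ> ?\<nu>) has_vector_derivative D \<nu>') (at t within I)"
    by (rule vector_derivative_diff_chain_within[OF \<nu>' has_derivative_at_withinI[OF D]])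
  moreover have "((?b \<circ> ?\<nu>) has_vector_derivative - (k *\<^sub>R ?b (\<eta> t))) (at t within I)"
    by (rule has_vector_derivative_transform[OF t(1) _ has_vector_derivative_minus[OF \<eta>']])
       (simp add: \<nu>(2))
  ultimately have "D \<nu>' = - (k *\<^sub>R ?b (\<eta> t))"
    using vector_derivative_unique_within t(2) trivial_limit_within by metis
  moreover have "\<nu>' = (- \<beta>) *\<^sub>R ?b (?\<nu> t)" by (simp add: \<beta> \<nu>(2)[OF t(1)])
  then have "D \<nu>' = (- \<beta>) *\<^sub>R D (?b (?\<nu> t))"
    using linear.scaleR[OF has_derivative_linear[OF D]] by metis
  ultimately have "norm ((- \<beta>) *\<^sub>R D (?b (?\<nu> t))) = norm (- (k *\<^sub>R ?b (\<eta> t)))" by simp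
  then have abs: "\<bar>\<beta>\<bar> * rho \<omega> (?\<nu> t) = \<bar>k\<bar>"
    using birkhoff_map(1)[OF \<eta>0] by (simp add: rho_def D_def)
  have sign: "0 \<le> \<omega> \<nu>' (- (k *\<^sub>R ?b (\<eta> t)))"
  proof (rule tendsto_lowerbound)
    have q: "((\<lambda>s. inverse (s - t) *\<^sub>R (f s - f t)) \<longlongrightarrow> f') (at t within I)"
      if "(f has_vector_derivative f') (at t within I)" for f and f' :: 'a
    proof -
      have "((\<lambda>s. norm ((1 / norm (s - t)) *\<^sub>R (f s - (f t + (s - t) *\<^sub>R f')))) \<longlongrightarrow> 0) (at t within I)"
        by (rule tendsto_norm_zero[OF conjunct2[OF that[unfolded has_vector_derivative_def has_derivative_within]]])
      moreover have "\<forall>\<^sub>F s in at t within I. norm ((1 / norm (s - t)) *\<^sub>R (f s - (f t + (s - t) *\<^sub>R f')))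
          = norm (inverse (s - t) *\<^sub>R (f s - f t) - f')"
      proof -
        have "norm ((1 / norm (s - t)) *\<^sub>R (f s - (f t + (s - t) *\<^sub>R f')))
            = norm (inverse (s - t) *\<^sub>R (f s - f t) - f')" if "s \<noteq> t" for s
        proof -
          have "inverse (s - t) *\<^sub>R (f s - f t) - f' = inverse (s - t) *\<^sub>R (f s - (f t + (s - t) *\<^sub>R f'))"
            using that by (simp add: scaleR_diff_right scaleR_add_right)
          then show ?thesis by (simp add: divide_inverse)
        qed
        then show ?thesis by (simp add: eventually_at_filter)
      qed
      ultimately have "((\<lambda>s. norm (inverse (s - t) *\<^sub>R (f s - f t) - f')) \<longlongrightarrow> 0) (at t within I)"
        by (rule Lim_transform_eventually)
      then show ?thesis by (rule LIM_zero_cancel[OF tendsto_norm_zero_cancel])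
    qed
    show "((\<lambda>s. \<omega> (inverse (s - t) *\<^sub>R (?\<nu> s - ?\<nu> t)) (inverse (s - t) *\<^sub>R (- \<eta> s - - \<eta> t)))
        \<longlongrightarrow> \<omega> \<nu>' (- (k *\<^sub>R ?b (\<eta> t)))) (at t within I)"
      by (intro omega.tendsto q \<nu>' has_vector_derivative_minus \<eta>')
    have "0 \<le> \<omega> (inverse (s - t) *\<^sub>R (?\<nu> s - ?\<nu> t)) (inverse (s - t) *\<^sub>R (- \<eta> s - - \<eta> t))"
      if s: "s \<in> I" for s
    proof -
      have "0 \<le> \<omega> (?\<nu> s - ?\<nu> t) (- \<eta> s - - \<eta> t)"
        using birkhoff_map_monotone[OF \<nu>(1)[OF t(1)] \<nu>(1)[OF s]] unfolding \<nu>(2)[OF t(1)] \<nu>(2)[OF s] .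
      then have "0 \<le> (inverse (s - t) * inverse (s - t)) * \<omega> (?\<nu> s - ?\<nu> t) (- \<eta> s - - \<eta> t)"
        by (intro mult_nonneg_nonneg zero_le_square)
      then show ?thesis by (simp only: omega.scaleR_left omega.scaleR_right real_scaleR_def mult.assoc)
    qed
    then show "\<forall>\<^sub>F s in at t within I.
        0 \<le> \<omega> (inverse (s - t) *\<^sub>R (?\<nu> s - ?\<nu> t)) (inverse (s - t) *\<^sub>R (- \<eta> s - - \<eta> t))"
      by (auto simp: eventually_at_filter)
    show "at t within I \<noteq> bot" using t(2) trivial_limit_within by blast
  qed
  then have "\<beta> * k \<le> 0" using birkhoff_map(3)[OF \<eta>0]
    by (simp add: \<beta> omega.scaleR_left omega.scaleR_right omega.minus_right mult_le_0_iff zero_le_mult_iff)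
       blast
  have "0 < rho \<omega> (?\<nu> t)" using abs k by (auto simp: rho_def zero_less_norm_iff)
  moreover have "- \<beta> * rho \<omega> (?\<nu> t) = k"
    using abs \<open>\<beta> * k \<le> 0\<close> k by (auto simp: abs_if mult_le_0_iff split: if_splits)
  ultimately have "\<beta> = - (k / rho \<omega> (?\<nu> t))" by (simp add: field_simps)
  then show ?thesis using \<beta> by (simp only:)
qed

end

section \<open>The curvature of the evolute\<close>

theorem theorem5p1:
  fixes \<omega> :: "'a::real_normed_vector \<Rightarrow> 'a \<Rightarrow> real"
    and \<gamma> \<eta> :: "real \<Rightarrow> 'a"
    and \<alpha> \<kappa> :: "real \<Rightarrow> real"
    and I :: "real set"
  assumes "dim (UNIV :: 'a set) = 2"
    and "smooth_closed_curve (sphere (0::'a) 1)"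
    and "\<not> (\<exists>x y :: 'a. x \<noteq> y \<and> closed_segment x y \<subseteq> sphere 0 1)"
    and "symplectic_form \<omega>"
    and "is_interval I" and "interior I \<noteq> {}"
    and "legendre_immersion I \<gamma> \<eta>"
    and "curvature_pair \<omega> I \<gamma> \<eta> \<alpha> \<kappa>"
    and "\<forall>t\<in>I. \<kappa> t \<noteq> 0"
    and "\<forall>t\<in>I. rho \<omega> (evolute_normal \<omega> \<eta> t) \<noteq> 0"
  shows "legendre_immersion I (evolute \<gamma> \<eta> \<alpha> \<kappa>) (evolute_normal \<omega> \<eta>) \<and>
    (\<forall>t\<in>I. (evolute \<gamma> \<eta> \<alpha> \<kappa> has_vector_derivative
        - vector_derivative (\<lambda>s. \<alpha> s / \<kappa> s) (at t within I) *\<^sub>R \<eta> t) (at t within I)) \<and>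
    (\<forall>t\<in>I. \<eta> t = - birkhoff_map \<omega> (evolute_normal \<omega> \<eta> t)) \<and>
    (\<exists>\<beta> :: real \<Rightarrow> real.
       (\<forall>t\<in>I. (evolute_normal \<omega> \<eta> has_vector_derivative \<beta> t *\<^sub>R \<eta> t) (at t within I)) \<and>
       curvature_pair \<omega> I (evolute \<gamma> \<eta> \<alpha> \<kappa>) (evolute_normal \<omega> \<eta>)
         (\<lambda>t. vector_derivative (\<lambda>s. \<alpha> s / \<kappa> s) (at t within I)) (\<lambda>t. - \<beta> t) \<and>
       (\<forall>t\<in>I. - \<beta> t = \<kappa> t / rho \<omega> (evolute_normal \<omega> \<eta> t)))"
proof -
  interpret smooth_plane \<omega> using assms(1,2,4) by unfold_locales
  let ?e = "evolute \<gamma> \<eta> \<alpha> \<kappa>" and ?\<nu> = "evolute_normal \<omega> \<eta>" and ?b = "birkhoff_map \<omega>"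
  let ?\<rho> = "\<lambda>t. rho \<omega> (?\<nu> t)"
  define q' where "q' t = vector_derivative (\<lambda>s. \<alpha> s / \<kappa> s) (at t within I)" for t
  have perf: "t islimpt I" if "t \<in> I" for t
  proof (rule connected_imp_perfect[OF _ that])
    show "connected I" using assms(5) is_interval_connected by blast
    show "I \<noteq> {x}" for x using assms(6) interior_singleton by metis
  qed
  note smoothD = smooth_on_imp_times_differentiable_on
  note smoothI = times_differentiable_on_imp_smooth_on[OF _ perf]
  have \<gamma>n: "times_differentiable_on n I \<gamma>" and \<eta>n: "times_differentiable_on n I \<eta>"
    and \<alpha>n: "times_differentiable_on n I \<alpha>" and \<kappa>n: "times_differentiable_on n I \<kappa>" for n
    using assms(7,8) smoothD by (auto simp: legendre_immersion_def legendre_curve_def curvature_pair_def)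
  have unit: "norm (\<eta> t) = 1" if "t \<in> I" for t
    using assms(7) that by (auto simp: legendre_immersion_def legendre_curve_def)
  have \<gamma>': "(\<gamma> has_vector_derivative \<alpha> t *\<^sub>R ?b (\<eta> t)) (at t within I)"
    and \<eta>': "(\<eta> has_vector_derivative \<kappa> t *\<^sub>R ?b (\<eta> t)) (at t within I)" if "t \<in> I" for t
    using vector_derivative_times_differentiable_on(1)[OF \<gamma>n perf that]
      vector_derivative_times_differentiable_on(1)[OF \<eta>n perf that] assms(8) that
    by (simp_all add: curvature_pair_def)
  have qn: "times_differentiable_on n I (\<lambda>t. \<alpha> t / \<kappa> t)" for n
    using assms(9) by (intro times_differentiable_on_divide \<alpha>n \<kappa>n) auto
  have q': "((\<lambda>t. \<alpha> t / \<kappa> t) has_vector_derivative q' t) (at t within I)" if "t \<in> I" for t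
    using vector_derivative_times_differentiable_on(1)[OF qn perf that] by (simp add: q'_def)
  have q'n: "times_differentiable_on n I q'" for n
    using vector_derivative_times_differentiable_on(2)[OF qn perf] by (simp add: q'_def[abs_def])
  have e': "(?e has_vector_derivative - q' t *\<^sub>R \<eta> t) (at t within I)" if t: "t \<in> I" for t
  proof -
    have "(?e has_vector_derivative \<alpha> t *\<^sub>R ?b (\<eta> t) -
        ((\<alpha> t / \<kappa> t) *\<^sub>R (\<kappa> t *\<^sub>R ?b (\<eta> t)) + q' t *\<^sub>R \<eta> t)) (at t within I)"
      unfolding evolute_def[abs_def] using q'[OF t]
      by (intro has_vector_derivative_diff has_vector_derivative_scaleR \<gamma>' \<eta>' t)
         (simp add: has_real_derivative_iff_has_vector_derivative)
    then show ?thesis using assms(9) t by simp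
  qed
  have en: "times_differentiable_on n I ?e" for n
    unfolding evolute_def[abs_def]
    by (intro times_differentiable_on_diff times_differentiable_on_scaleR \<gamma>n \<eta>n qn)
  have \<nu>n: "times_differentiable_on n I ?\<nu>" for n
    using smooth_evolute_normal[OF assms(3) perf \<eta>n unit] assms(10) by blast
  note \<nu> = evolute_normal(1,2)[where \<eta>=\<eta>, OF assms(3) unit]
  define \<beta> where "\<beta> t = - (\<kappa> t / ?\<rho> t)" for t
  have \<nu>': "(?\<nu> has_vector_derivative \<beta> t *\<^sub>R \<eta> t) (at t within I)" if t: "t \<in> I" for t
    using vector_derivative_times_differentiable_on(1)[OF \<nu>n perf t]
      evolute_normal_derivative[OF assms(3) t perf[OF t] unit _ \<eta>'[OF t]] assms(9) t
    unfolding \<beta>_def by metis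
  have vd: "vector_derivative f (at t within I) = f'"
    if "(f has_vector_derivative f') (at t within I)" "t \<in> I" for f t and f' :: 'a
    using vector_derivative_within[OF _ that(1)] perf[OF that(2)] trivial_limit_within by metis
  have \<beta>0: "\<beta> t \<noteq> 0" if "t \<in> I" for t using that assms(9,10) by (simp add: \<beta>_def)
  have \<nu>0: "?\<nu> t \<noteq> 0" and \<eta>0: "\<eta> t \<noteq> 0" if "t \<in> I" for t using \<nu>(1)[OF that] unit[OF that] by auto
  have \<beta>n: "times_differentiable_on n I (\<lambda>t. - \<beta> t)" for n
  proof (rule times_differentiable_on_cong)
    have \<nu>\<eta>: "\<omega> (?\<nu> t) (\<eta> t) \<noteq> 0" if "t \<in> I" for t
      using birkhoff_map(3)[OF \<nu>0[OF that]] \<nu>(2)[OF that] by (auto simp: omega.minus_right)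
    \<comment> \<open>\<open>\<kappa> / rho\<close> shows no smoothness; the coefficient of \<open>\<nu>'\<close> with respect to \<open>\<eta>\<close> does\<close>
    show "times_differentiable_on n I
        (\<lambda>t. - (\<omega> (?\<nu> t) (vector_derivative ?\<nu> (at t within I)) / \<omega> (?\<nu> t) (\<eta> t)))"
      using \<nu>\<eta> vector_derivative_times_differentiable_on(2)[OF \<nu>n perf]
      by (intro times_differentiable_on_minus times_differentiable_on_divide
          times_differentiable_on_bilinear[OF omega.bounded_bilinear_axioms] \<nu>n \<eta>n) auto
    show "- (\<omega> (?\<nu> t) (vector_derivative ?\<nu> (at t within I)) / \<omega> (?\<nu> t) (\<eta> t)) = - \<beta> t"
      if "t \<in> I" for t
      using vd[OF \<nu>'[OF that] that] \<nu>\<eta>[OF that] by (simp add: omega.scaleR_right)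
  qed
  have "birkhoff_orth (?\<nu> t) (- q' t *\<^sub>R \<eta> t)" if "t \<in> I" for t
    using birkhoff_orth_scaleR[OF birkhoff_map(2)[OF \<nu>0[OF that]], of 1 "q' t"] \<nu>(2)[OF that] by simp
  then have "legendre_immersion I ?e ?\<nu>"
    using smoothI[OF en] smoothI[OF \<nu>n] \<nu>(1) vd[OF e'] vd[OF \<nu>'] \<beta>0 \<eta>0
    by (simp add: legendre_immersion_def legendre_curve_def)
  moreover have "curvature_pair \<omega> I ?e ?\<nu> q' (\<lambda>t. - \<beta> t)"
    using smoothI[OF q'n] smoothI[OF \<beta>n] vd[OF e'] vd[OF \<nu>'] \<nu>(2)
    by (simp add: curvature_pair_def)
  moreover have "\<eta> t = - ?b (?\<nu> t)" if "t \<in> I" for t using \<nu>(2)[OF that] by simp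
  moreover have "- \<beta> t = \<kappa> t / ?\<rho> t" for t by (simp add: \<beta>_def)
  ultimately show ?thesis unfolding q'_def[symmetric] using e' \<nu>' by blast
qed

end
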